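(* Let $k\in\mathbb{N}$, let $\mathbf{y}\in\mathbb{R}^k$, and let $\psi:\mathbb{N}\to[0,1)$. (a) If $\sum_{n=1}^\infty \psi(n)(\log n)^{k-1}<\infty$, then $\lambda_k(W_k^\times(\psi,\mathbf{y}))=0$. (b) Assume that $k\ge 3$ and that $\psi(n)\ll n^{-\varepsilon}$ for some constant $\varepsilon\in(0,1]$. If $\sum_{n=1}^\infty \psi(n)(\log n)^{k-1}=\infty$, then $\lambda_k(W_k^\times(\psi,\mathbf{y}))=1$.
   Context: $\lambda_k$ denotes $k$-dimensional Lebesgue measure. For $x \in \mathbb{R}$, $\|x\|$ denotes the distance from $x$ to the nearest integer. For $\psi:\mathbb{N}\to[0,1)$ and $\mathbf{y}\in\mathbb{R}^k$, $W_k^\times(\psi,\mathbf{y})$ is the set of $\mathbf{x}\in[0,1)^k$ such that $\|nx_1-y_1\|\cdots\|nx_k-y_k\|<\psi(n)$ holds for infinitely many $n\in\mathbb{N}$. *)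

theory Defs
  imports "HOL-Analysis.Analysis" "HOL-Library.Landau_Symbols"
begin

definition dist_int :: "real \<Rightarrow> real" where
  "dist_int x = infdist x \<int>"

(* The natural numbers of the source are the positive integers, hence the guard n >= 1;
   the dimension k is CARD('k). *)
definition W_mult :: "(nat \<Rightarrow> real) \<Rightarrow> real ^ 'k \<Rightarrow> (real ^ 'k) set" where
  "W_mult \<psi> y =
     {x. (\<forall>i. 0 \<le> x $ i \<and> x $ i < 1) \<and>
         infinite {n. n \<ge> 1 \<and> (\<Prod>i\<in>UNIV. dist_int (real n * x $ i - y $ i)) < \<psi> n}}"

end

(* Convergence: the hyperbolic region prod ||n x_i - y_i|| < psi(n) is covered by about
   (log 1/psi)^(k-1) dyadic boxes of volume comparable to psi, after replacing psi(n) by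
   max(psi(n), n^-2), so that log 1/psi(n) = O(log n); then apply Borel-Cantelli.

   Divergence: let A_n be the part of the n-th region made of the dyadic boxes
   frac(n x_i - y_i) in [2^(-s_i-1), 2^(-s_i)) with s_1 + ... + s_k = N and all s_i >= N/(2k), where
   2^-N is about psi(n).  Since psi(n) << n^-eps, these boxes carry a positive proportion of the
   volume psi(n) (log n)^(k-1), and each side is at most q n^-eta.  If n x is given, then x runs through
   a grid and m x through the shifted grid of mesh 1/r, r = n/gcd(m,n).  Counting grid points
   in boxes gives, for every K >= 1,
     |A_m inter A_n| <= |A_n| ((1 + 1/K)^k |A_m| + C_K (r^-3 + r^-1 m^-eta)),
   where k >= 3 enters through r^-k <= r^-3.  By the divisor bound the error terms have
   a bounded sum over m < n.  So Chebyshev's inequality bounds the measure of the points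
   in none of the A_n, n >= n_0, by 2 delta for every delta > 0: the leading constant is arbitrarily close to 1,
   and no zero-one law is needed. *)

theory Submission
  imports Defs "HOL-Number_Theory.Number_Theory"
begin

section \<open>Counting points of a shifted grid\<close>

text \<open>The obstacle is the rounding error of the grid count. In one coordinate the conditional
  proportion of a shell is its length plus an error of at most 1/r, and paying this for every shell
  separately would cost factors of log n. Two facts avoid this: consecutive shells lie in one
  interval [0, 2^-a), so a whole tail of shells pays 1/r only once, and a shell of length at least
  K/r absorbs the error into 1 + 1/K. The lower bound on the s_i handles tuples with both short and
  long sides: a short side gives O(1/r), and the long one gives a power saving.

  The exponent 3 is a threshold. Each r dividing n arises from at most r values of m, so r^-3 leaves
  the sum of r^-2, whereas r^-2 would leave a sum of size about 1/r over all divisors r of n, which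
  is unbounded in n.

  The shells use fractional parts, hence only one side of each integer. This costs a constant factor
  in volume, harmless for divergence, while the leading constant of the overlap estimate is relative
  to the measures of the A_n themselves and stays sharp.\<close>

lemma card_int_in_interval:
  fixes u v :: real
  assumes "u \<le> v"
  shows "finite {j::int. of_int j \<in> {u..<v}}" "real (card {j::int. of_int j \<in> {u..<v}}) \<le> v - u + 1"
proof -
  have eq: "{j::int. of_int j \<in> {u..<v}} = {\<lceil>u\<rceil>..<\<lceil>v\<rceil>}"
    by (auto simp: ceiling_le_iff less_ceiling_iff)
  show "finite {j::int. of_int j \<in> {u..<v}}" unfolding eq by simp
  show "real (card {j::int. of_int j \<in> {u..<v}}) \<le> v - u + 1" unfolding eq
    using ceiling_mono[OF assms] by (simp; linarith)
qed

text \<open>With d = gcd m n and r = n / d, the values m t / n + w modulo 1 form a shifted grid of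
  mesh 1/r, each point being hit d times. At most r (b - a) + 1 grid points lie in [a, b), and d (r
  (b - a) + 1) = n (b - a) + d.\<close>

lemma card_frac_grid_le:
  fixes m n :: nat and a b w :: real
  assumes n: "0 < n" and ab: "a \<le> b"
  shows "real (card {t. t < n \<and> frac (real m * real t / real n + w) \<in> {a..<b}})
           \<le> real n * (b - a) + real (gcd m n)"
proof -
  define d where "d = gcd m n"
  define r where "r = n div d"
  define m' where "m' = m div d"
  have d0: "d > 0" using n by (simp add: d_def)
  have nr: "n = r * d" and mr: "m = m' * d" by (auto simp: r_def m'_def d_def)
  have r0: "r > 0" using n nr by (cases r) auto
  have cop: "coprime m' r" unfolding m'_def r_def d_def using n by (intro div_gcd_coprime) auto
  define x where "x t = real m * real t / real n + w" for t :: nat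
  have x_eq: "x t = real m' * real t / real r + w" for t
    using d0 by (simp add: x_def nr mr)
  \<comment> \<open>\<open>th\<close> is the offset of the grid after scaling by r: r times each
    fractional part is an integer \<open>j t\<close> plus this common offset.\<close>
  define th where "th = frac (real r * w)"
  define j where "j t = int m' * int t + \<lfloor>real r * w\<rfloor> - int r * \<lfloor>x t\<rfloor>" for t
  have key: "real r * frac (x t) = of_int (j t) + th" for t
    using r0 by (simp add: frac_def x_eq j_def th_def field_simps)
  let ?T = "{t. t < n \<and> frac (x t) \<in> {a..<b}}"
  let ?J = "{i::int. of_int i \<in> {real r * a - th..<real r * b - th}}"
  let ?f = "\<lambda>t. (t div r, j t)"
  \<comment> \<open>Equal \<open>j\<close> forces m' s = m' t modulo r, hence s = t modulo r by
    coprimality; \<open>t div r\<close> records the period.\<close>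
  have inj: "inj_on ?f ?T"
  proof (rule inj_onI)
    fix s t assume s: "s \<in> ?T" and t: "t \<in> ?T" and eq: "?f s = ?f t"
    have "int m' * int s - int m' * int t = int r * (\<lfloor>x s\<rfloor> - \<lfloor>x t\<rfloor>)"
      using eq by (simp add: j_def algebra_simps)
    hence "[int m' * int s = int m' * int t] (mod int r)" by (simp add: cong_iff_dvd_diff)
    hence "[m' * s = m' * t] (mod r)" by (metis cong_int_iff of_nat_mult)
    hence "[s = t] (mod r)" using cop by (simp add: cong_mult_lcancel_nat coprime_commute)
    hence "s mod r = t mod r" by (simp add: cong_def)
    with eq show "s = t" by (metis Pair_inject div_mult_mod_eq)
  qed
  have sub: "?f ` ?T \<subseteq> {..<d} \<times> ?J"
  proof (rule image_subsetI)
    fix t assume t: "t \<in> ?T"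
    have 1: "t div r < d" using t r0 by (simp add: nr div_less_iff_less_mult mult.commute)
    have "real r * a \<le> real r * frac (x t)" "real r * frac (x t) < real r * b"
      using t r0 by auto
    thus "?f t \<in> {..<d} \<times> ?J" using 1 by (simp add: key algebra_simps)
  qed
  have le: "real r * a - th \<le> real r * b - th" using ab r0 by simp
  note J = card_int_in_interval[OF le]
  have "card ?T \<le> card ({..<d} \<times> ?J)"
    by (rule card_inj_on_le[OF inj sub]) (intro finite_cartesian_product finite_lessThan J(1))
  also have "\<dots> = d * card ?J" by (simp only: card_cartesian_product card_lessThan)
  finally have "real (card ?T) \<le> real d * real (card ?J)" by (simp only: of_nat_le_iff flip: of_nat_mult)
  also have "\<dots> \<le> real d * (real r * b - th - (real r * a - th) + 1)"
    by (rule mult_left_mono[OF J(2) of_nat_0_le_iff])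
  also have "\<dots> = real n * (b - a) + real d" by (simp add: nr algebra_simps)
  finally show ?thesis by (simp add: x_def d_def)
qed

section \<open>Orbits on the circle and product sets\<close>

lemma borel_vec_box:
  fixes E :: "'k::finite \<Rightarrow> real set"
  assumes "\<And>i. E i \<in> sets borel"
  shows "{x :: real ^ 'k. \<forall>i. x $ i \<in> E i} \<in> sets borel"
proof -
  have "{x::real^'k. x $ i \<in> E i} \<in> sets borel" for i
    using pred_sets2[OF assms, of "\<lambda>x::real^'k. x $ i" borel i]
    by (simp add: pred_def borel_measurable_continuous_onI continuous_intros)
  hence "(\<Inter>i\<in>UNIV. {x::real^'k. x $ i \<in> E i}) \<in> sets borel"
    by (intro sets.finite_INT) auto
  also have "(\<Inter>i\<in>UNIV. {x::real^'k. x $ i \<in> E i}) = {x. \<forall>i. x $ i \<in> E i}" by auto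
  finally show ?thesis .
qed

text \<open>Fubini over the standard basis: the indicator of the product set is a product of
  coordinate indicators, and \<open>axis_index\<close> turns a basis vector back into its
  coordinate.\<close>

lemma emeasure_lborel_vec_prod:
  fixes E :: "'k::finite \<Rightarrow> real set"
  assumes E: "\<And>i. E i \<in> sets borel"
  shows "emeasure lborel {x :: real ^ 'k. \<forall>i. x $ i \<in> E i} = (\<Prod>i\<in>UNIV. emeasure lborel (E i))"
proof -
  let ?f = "\<lambda>b::real^'k. indicator (E (axis_index b)) :: real \<Rightarrow> ennreal"
  have B: "(Basis :: (real^'k) set) = range (\<lambda>i. axis i 1)" by (auto simp: Basis_vec_def)
  have inj: "inj (\<lambda>i::'k. axis i (1::real))" by (auto simp: inj_on_def axis_eq_axis)
  have ai: "axis_index (axis i (1::real)) = i" for i :: 'k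
    by (simp add: axis_index_axis)
  note borel_vec_box[OF E, measurable]
  have "(\<Prod>b\<in>Basis. ?f b (x \<bullet> b)) = indicator {x :: real ^ 'k. \<forall>i. x $ i \<in> E i} x" for x :: "real^'k"
    unfolding B using inj by (simp add: prod.reindex ai inner_axis indicator_def prod_zero_iff)
  hence "emeasure lborel {x :: real ^ 'k. \<forall>i. x $ i \<in> E i}
    = (\<integral>\<^sup>+ x. (\<Prod>b\<in>Basis. ?f b (x \<bullet> b)) \<partial>lborel)"
    by simp
  also have "\<dots> = (\<Prod>b\<in>Basis. (\<integral>\<^sup>+x. ?f b x \<partial>lborel))"
    using E by (intro nn_integral_lborel_prod) (auto intro!: borel_measurable_indicator)
  also have "\<dots> = (\<Prod>b\<in>Basis. emeasure lborel (E (axis_index (b::real^'k))))"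
    using E by simp
  also have "\<dots> = (\<Prod>i\<in>UNIV. emeasure lborel (E i))"
    unfolding B using inj by (simp add: prod.reindex ai)
  finally show ?thesis .
qed

lemma enn2real_prod: "enn2real (\<Prod>i\<in>S. f i) = (\<Prod>i\<in>S. enn2real (f i))"
  by (induction S rule: infinite_finite_induct) (auto simp: enn2real_mult)

lemma measure_lborel_vec_prod:
  fixes E :: "'k::finite \<Rightarrow> real set"
  assumes "\<And>i. E i \<in> sets borel"
  shows "measure lborel {x :: real ^ 'k. \<forall>i. x $ i \<in> E i} = (\<Prod>i\<in>UNIV. measure lborel (E i))"
  unfolding measure_def by (simp add: emeasure_lborel_vec_prod[OF assms] enn2real_prod)

text \<open>The unit interval is cut into the cells [t/n, (t+1)/n) and each is stretched to [0, 1)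
  by x = (t + z) / n. There n x = t + z, so a condition on frac (n x - y) becomes the same condition
  on z in every cell.\<close>

lemma measure_cells:
  fixes S :: "real set"
  assumes n: "0 < n" and S: "S \<in> sets borel" "S \<subseteq> {0..<1}"
  shows "measure lborel S = (\<Sum>t<n. measure lborel {z\<in>{0..<1}. (real t + z) / real n \<in> S}) / real n"
proof -
  let ?c = "\<lambda>t. S \<inter> {real t / real n..<(real t + 1) / real n}"
  have cell: "measure lborel (?c t) = measure lborel {z\<in>{0..<1}. (real t + z) / real n \<in> S} / real n" for t
  proof -
    have "emeasure lborel (?c t) = (\<integral>\<^sup>+ x. indicator (?c t) x \<partial>lborel)"
      using S by simp
    also have "\<dots> = ennreal \<bar>1 / real n\<bar> * (\<integral>\<^sup>+ z. indicator (?c t) (real t / real n + 1 / real n * z) \<partial>lborel)"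
      using S n by (intro nn_integral_real_affine) auto
    also have "(\<lambda>z. indicator (?c t) (real t / real n + 1 / real n * z) :: ennreal)
        = indicator {z\<in>{0..<1}. (real t + z) / real n \<in> S}"
    proof
      fix z
      have "real t / real n + 1 / real n * z = (real t + z) / real n" by (simp add: add_divide_distrib)
      moreover have "(real t + z) / real n \<in> {real t / real n..<(real t + 1) / real n} \<longleftrightarrow> z \<in> {0..<1}"
        using n by (simp add: divide_le_cancel divide_less_cancel)
      ultimately have "real t / real n + 1 / real n * z \<in> ?c t
          \<longleftrightarrow> z \<in> {z\<in>{0..<1}. (real t + z) / real n \<in> S}"
        by (simp only: Int_iff mem_Collect_eq conj_commute)
      thus "indicator (?c t) (real t / real n + 1 / real n * z)
          = (indicator {z\<in>{0..<1}. (real t + z) / real n \<in> S} z :: ennreal)"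
        by (simp only: indicator_def)
    qed
    also have "(\<integral>\<^sup>+ z. indicator {z\<in>{0..<1}. (real t + z) / real n \<in> S} z \<partial>lborel)
       = emeasure lborel {z\<in>{0..<1}. (real t + z) / real n \<in> S}"
    proof (rule nn_integral_indicator)
      have "(\<lambda>z. (real t + z) / real n) \<in> borel_measurable borel" by measurable
      from measurable_sets[OF this S(1)]
      show "{z\<in>{0..<1}. (real t + z) / real n \<in> S} \<in> sets lborel"
        by (simp add: vimage_def Collect_conj_eq)
    qed
    finally show ?thesis by (simp add: measure_def enn2real_mult)
  qed
  have "S = (\<Union>t<n. ?c t)"
  proof (intro equalityI subsetI)
    fix x assume x: "x \<in> S"
    with S have x01: "0 \<le> x" "x < 1" by auto
    define t where "t = nat \<lfloor>real n * x\<rfloor>"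
    have t: "real t = of_int \<lfloor>real n * x\<rfloor>" using x01 by (simp add: t_def)
    have "real t \<le> real n * x" "real n * x < real t + 1" unfolding t by linarith+
    moreover have "real n * x < real n" using x01 n by simp
    ultimately have "real t < real n" by linarith
    with \<open>real t \<le> real n * x\<close> \<open>real n * x < real t + 1\<close> have "t < n" "x \<in> {real t / real n..<(real t + 1) / real n}"
      using n by (auto simp: field_simps)
    thus "x \<in> (\<Union>t<n. ?c t)" using x by auto
  qed auto
  hence "measure lborel S = measure lborel (\<Union>t<n. ?c t)" by simp
  also have "\<dots> = (\<Sum>t<n. measure lborel (?c t))"
  proof (rule measure_finite_Union)
    show "disjoint_family_on ?c {..<n}"
    proof (unfold disjoint_family_on_def, intro ballI impI, rule ccontr)
      fix s t assume "s \<noteq> t" "?c s \<inter> ?c t \<noteq> {}"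
      then obtain x where "real s \<le> n * x" "n * x < real s + 1" "real t \<le> n * x" "n * x < real t + 1"
        using n by (auto simp: field_simps)
      with \<open>s \<noteq> t\<close> show False by linarith
    qed
    show "emeasure lborel (?c t) \<noteq> \<infinity>" for t
    proof -
      have "emeasure lborel (?c t) \<le> emeasure lborel {real t / real n..<(real t + 1) / real n}"
        by (rule emeasure_mono) auto
      also have "\<dots> < \<infinity>" using n by (simp add: divide_right_mono)
      finally show ?thesis by simp
    qed
  qed (use S in auto)
  finally show ?thesis by (simp add: cell sum_divide_distrib)
qed

section \<open>Rotations of the circle and preimages of arcs under x -> n x - y\<close>

lemma frac_diff_unit:
  fixes z y :: real
  assumes "0 \<le> z" "z < 1"
  shows "frac (z - y) = (if frac y \<le> z then z - frac y else z - frac y + 1)"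
proof -
  have "z - y - (if frac y \<le> z then z - frac y else z - frac y + 1) \<in> \<int>"
    by (simp add: frac_def)
  thus ?thesis
    unfolding frac_unique_iff using assms frac_ge_0[of y] frac_lt_1[of y] by (simp split: if_splits; linarith)
qed

text \<open>Preimage of an arc of the circle under x -> n x - y. With \<open>frac\<close> in place
  of \<open>dist_int\<close>, closeness to an integer from above is a single interval [0,
  c).\<close>

definition hits :: "nat \<Rightarrow> real \<Rightarrow> real \<Rightarrow> real \<Rightarrow> real set" where
  "hits n y c d = {x\<in>{0..<1}. frac (real n * x - y) \<in> {c..<d}}"

lemma hits_borel [measurable]: "hits n y c d \<in> sets borel"
  unfolding hits_def frac_def by measurable

lemma hits_subset: "hits n y c d \<subseteq> {0..<1}"
  by (auto simp: hits_def)

lemma emeasure_unit_subset_finite: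
  assumes "S \<subseteq> {0..<1::real}" shows "emeasure lborel S \<noteq> \<infinity>"
proof -
  have "emeasure lborel S \<le> emeasure lborel {0..<1::real}"
    using assms by (rule emeasure_mono) auto
  also have "\<dots> < \<infinity>" by simp
  finally show ?thesis by simp
qed

lemma measure_lborel_Ico_max: "measure lborel {u..<v::real} = max 0 (v - u)"
  by (cases "u \<le> v") auto

text \<open>Rotation by y preserves length. In [0, 1) the rotated arc may wrap around 1:
  \<open>?A\<close> is the part before the wrap and \<open>?B\<close> the part after it. Either may
  be empty, which is why the lengths go through \<open>max 0\<close>.\<close>

lemma measure_hits_1:
  assumes "0 \<le> c" "c \<le> d" "d \<le> 1"
  shows "measure lborel {z\<in>{0..<1}. frac (z - y) \<in> {c..<d}} = d - c"
proof -
  let ?y = "frac y"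
  let ?A = "{?y + c..<min 1 (?y + d)}" and ?B = "{max 0 (?y + c - 1)..<?y + d - 1}"
  have y: "0 \<le> ?y" "?y < 1" by (auto simp: frac_lt_1)
  have "{z\<in>{0..<1}. frac (z - y) \<in> {c..<d}} = ?A \<union> ?B"
  proof (unfold set_eq_iff, rule allI)
    fix x :: real
    show "x \<in> {z\<in>{0..<1}. frac (z - y) \<in> {c..<d}} \<longleftrightarrow> x \<in> ?A \<union> ?B"
    proof (cases "0 \<le> x \<and> x < 1")
      case True
      thus ?thesis using assms y by (simp add: frac_diff_unit; linarith)
    next
      case False
      thus ?thesis using assms y by (simp; linarith)
    qed
  qed
  moreover have "?A \<inter> ?B = {}" using assms by auto
  ultimately have "measure lborel {z\<in>{0..<1}. frac (z - y) \<in> {c..<d}} = measure lborel ?A + measure lborel ?B"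
    using assms y by (simp only:) (intro measure_Union emeasure_unit_subset_finite; auto)
  also have "\<dots> = d - c" using assms y by (simp add: measure_lborel_Ico_max)
  finally show ?thesis .
qed

lemma frac_cell: "frac (real t + z - y) = frac (z - y)"
proof -
  have "real t + (z - y - frac (z - y)) \<in> \<int>" by (simp add: frac_def)
  hence "real t + z - y - frac (z - y) \<in> \<int>" by (simp add: algebra_simps)
  thus ?thesis by (simp add: frac_unique_iff frac_lt_1)
qed

text \<open>All n cells see the same rotated arc, so they contribute equally.\<close>

lemma measure_hits:
  assumes "0 < n" "0 \<le> c" "c \<le> d" "d \<le> 1"
  shows "measure lborel (hits n y c d) = d - c"
proof -
  have "z\<in>{0..<1} \<Longrightarrow> t < n \<Longrightarrow> (real t + z) / real n \<in> {0..<1}" for t z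
    by (auto simp: field_simps)
  hence "{z\<in>{0..<1}. (real t + z) / real n \<in> hits n y c d} = {z\<in>{0..<1}. frac (z - y) \<in> {c..<d}}" if "t < n" for t
    using that assms by (auto simp: hits_def frac_cell)
  thus ?thesis
    using assms by (subst measure_cells[OF assms(1) hits_borel hits_subset]) (simp add: measure_hits_1 del: mem_Collect_eq atLeastLessThan_iff)
qed

text \<open>Double counting: the sum is the integral of the number of sets \<open>Y t\<close>
  containing a point, which is at most C on Z and 0 off Z.\<close>

lemma sum_measure_le_multiplicity:
  assumes "finite I" and Z: "Z \<in> sets M" "emeasure M Z \<noteq> \<infinity>"
    and Zt: "\<And>t. t \<in> I \<Longrightarrow> Y t \<in> sets M" "\<And>t. t \<in> I \<Longrightarrow> Y t \<subseteq> Z"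
    and C: "\<And>z. z \<in> Z \<Longrightarrow> real (card {t\<in>I. z \<in> Y t}) \<le> C"
  shows "(\<Sum>t\<in>I. measure M (Y t)) \<le> C * measure M Z"
proof -
  have fin: "emeasure M (Y t) < \<infinity>" if "t \<in> I" for t
    using emeasure_mono[OF Zt(2)[OF that] Z(1)] Z(2) by (simp add: less_top order_le_less_trans)
  have int: "integrable M (indicator (Y t) :: _ \<Rightarrow> real)" if "t \<in> I" for t
    using Zt(1) fin that by simp
  have "(\<Sum>t\<in>I. measure M (Y t)) = (\<integral>x. (\<Sum>t\<in>I. indicator (Y t) x) \<partial>M)"
    using Zt(1) sets.sets_into_space[OF Zt(1)] int by (subst Bochner_Integration.integral_sum) (auto simp: Int_absorb2 intro!: sum.cong)
  also have "\<dots> \<le> (\<integral>x. C * indicator Z x \<partial>M)"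
  proof (rule integral_mono)
    show "integrable M (\<lambda>x. \<Sum>t\<in>I. indicator (Y t) x :: real)" using int by auto
    show "integrable M (\<lambda>x. C * indicator Z x)" using Z by (auto simp: less_top)
    fix x
    have "(\<Sum>t\<in>I. indicator (Y t) x :: real) = real (card {t\<in>I. x \<in> Y t})"
      using \<open>finite I\<close> by (simp add: indicator_def sum.If_cases Int_def)
    also have "\<dots> \<le> C * indicator Z x"
    proof (cases "x \<in> Z")
      case False
      hence "{t\<in>I. x \<in> Y t} = {}" using Zt(2) by auto
      hence "card {t\<in>I. x \<in> Y t} = 0" by (simp only: card.empty)
      thus ?thesis using False by simp
    qed (use C in auto)
    finally show "(\<Sum>t\<in>I. indicator (Y t) x) \<le> C * indicator Z x" .
  qed
  also have "\<dots> = C * measure M Z" using Z sets.sets_into_space[OF Z(1)] by (simp add: Int_absorb2)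
  finally show ?thesis .
qed

lemma measure_hits_Int_le:
  assumes n: "0 < n" and ab: "a \<le> b" and cd: "0 \<le> c" "c \<le> d" "d \<le> 1"
  shows "measure lborel (hits m y a b \<inter> hits n y c d) \<le> (d - c) * ((b - a) + real (gcd m n) / real n)"
proof -
  let ?S = "hits m y a b \<inter> hits n y c d"
  let ?Z = "{z\<in>{0..<1}. frac (z - y) \<in> {c..<d}}"
  let ?Y = "\<lambda>t. {z\<in>{0..<1}. (real t + z) / real n \<in> ?S}"
  (* z is the fractional part of n x; the n points x over a given z form a grid. *)
  have "(\<Sum>t<n. measure lborel (?Y t)) \<le> (n * (b - a) + gcd m n) * measure lborel ?Z"
  proof (rule sum_measure_le_multiplicity)
    show "?Z \<in> sets lborel" unfolding frac_def by measurable
    show "emeasure lborel ?Z \<noteq> \<infinity>" by (rule emeasure_unit_subset_finite) auto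
    show "?Y t \<in> sets lborel" for t unfolding hits_def frac_def by measurable
    show "?Y t \<subseteq> ?Z" for t using n by (auto simp: hits_def frac_cell)
    fix z
    \<comment> \<open>In cell t the value m x - y is m t / n plus an offset depending on z alone, so
      the count is uniform in z.\<close>
    have "real (card {t\<in>{..<n}. z \<in> ?Y t}) \<le> real (card {t. t < n \<and> frac (real m * real t / real n + (real m * z / real n - y)) \<in> {a..<b}})"
      by (intro of_nat_mono card_mono) (auto simp: hits_def add_divide_distrib algebra_simps)
    also have "\<dots> \<le> n * (b - a) + gcd m n" by (rule card_frac_grid_le[OF n ab])
    finally show "real (card {t\<in>{..<n}. z \<in> ?Y t}) \<le> n * (b - a) + gcd m n" .
  qed simp
  also have "measure lborel ?Z = d - c" by (rule measure_hits_1[OF cd])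
  finally have "(\<Sum>t<n. measure lborel (?Y t)) / n \<le> ((n * (b - a) + gcd m n) * (d - c)) / n"
    by (rule divide_right_mono) simp
  also have "\<dots> = (d - c) * ((b - a) + real (gcd m n) / real n)" using n by (simp add: field_simps)
  moreover have "?S \<in> sets borel" "?S \<subseteq> {0..<1}" using hits_subset by (measurable, blast)
  ultimately show ?thesis by (simp only: measure_cells[OF n])
qed

section \<open>A second-moment criterion for full measure\<close>

text \<open>Let S(x) be the number of n in I with x in \<open>A n\<close>; its integral is E. Off
  the union S = 0, so E^2 times the indicator of the complement is at most (E - S)^2 everywhere.
  Integrating the expanded square gives the second moment minus E^2.\<close>

lemma chebyshev_union_complement:
  fixes A :: "nat \<Rightarrow> 'a set"
  assumes M: "finite_measure M" and M1: "measure M (space M) = 1"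
    and A: "\<And>n. A n \<in> sets M" and I: "finite I"
    and E: "E = (\<Sum>n\<in>I. measure M (A n))"
  shows "E\<^sup>2 * measure M (space M - (\<Union>n\<in>I. A n))
     \<le> (\<Sum>m\<in>I. \<Sum>n\<in>I. measure M (A m \<inter> A n)) - E\<^sup>2"
proof -
  interpret finite_measure M by fact
  let ?S = "\<lambda>x. \<Sum>n\<in>I. indicator (A n) x :: real"
  let ?Z = "space M - (\<Union>n\<in>I. A n)"
  have Z: "?Z \<in> sets M" using A I by auto
  have sp: "B \<inter> space M = B" if "B \<in> sets M" for B using sets.sets_into_space[OF that] by auto
  have "E\<^sup>2 * measure M ?Z = (\<integral>x. E\<^sup>2 * indicator ?Z x \<partial>M)"
    using sp[OF Z] by simp
  also have "\<dots> \<le> (\<integral>x. (\<Sum>m\<in>I. \<Sum>n\<in>I. indicator (A m \<inter> A n) x) + (E\<^sup>2 - 2 * E * ?S x) \<partial>M)"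
  proof (rule integral_mono)
    show "integrable M (\<lambda>x. E\<^sup>2 * indicator ?Z x)" using Z by (auto simp: less_top[symmetric])
    show "integrable M (\<lambda>x. (\<Sum>m\<in>I. \<Sum>n\<in>I. indicator (A m \<inter> A n) x) + (E\<^sup>2 - 2 * E * ?S x))"
      using A by (auto simp: less_top[symmetric] intro!: Bochner_Integration.integrable_add Bochner_Integration.integrable_diff Bochner_Integration.integrable_sum)
    fix x assume x: "x \<in> space M"
    have "(\<Sum>m\<in>I. \<Sum>n\<in>I. indicator (A m \<inter> A n) x :: real) = ?S x * ?S x"
      by (simp add: sum_product indicator_inter_arith)
    hence eq: "(\<Sum>m\<in>I. \<Sum>n\<in>I. indicator (A m \<inter> A n) x) + (E\<^sup>2 - 2 * E * ?S x) = (E - ?S x)\<^sup>2"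
      by (simp add: power2_eq_square algebra_simps)
    have "E\<^sup>2 * indicator ?Z x \<le> (E - ?S x)\<^sup>2"
    proof (cases "x \<in> ?Z")
      case True
      hence "?S x = 0" by (intro sum.neutral) auto
      thus ?thesis by (simp add: indicator_def)
    next
      case False
      thus ?thesis by simp
    qed
    thus "E\<^sup>2 * indicator ?Z x \<le> (\<Sum>m\<in>I. \<Sum>n\<in>I. indicator (A m \<inter> A n) x) + (E\<^sup>2 - 2 * E * ?S x)"
      by (simp only: eq)
  qed
  also have "\<dots> = (\<Sum>m\<in>I. \<Sum>n\<in>I. measure M (A m \<inter> A n)) + (E\<^sup>2 - 2 * E * E)"
  proof -
    have i1: "(\<integral>x. (\<Sum>m\<in>I. \<Sum>n\<in>I. indicator (A m \<inter> A n) x :: real) \<partial>M) = (\<Sum>m\<in>I. \<Sum>n\<in>I. measure M (A m \<inter> A n))"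
      using A by (subst Bochner_Integration.integral_sum, force simp: less_top[symmetric] intro!: Bochner_Integration.integrable_sum)
         (intro sum.cong refl, subst Bochner_Integration.integral_sum, auto simp: less_top[symmetric] sp)
    have i2: "(\<integral>x. ?S x \<partial>M) = E"
      using A unfolding E by (subst Bochner_Integration.integral_sum) (auto simp: less_top[symmetric] sp)
    have int2: "integrable M ?S" using A by (auto simp: less_top[symmetric])
    have int1: "integrable M (\<lambda>x. (\<Sum>m\<in>I. \<Sum>n\<in>I. indicator (A m \<inter> A n) x :: real))"
      using A by (auto simp: less_top[symmetric] intro!: Bochner_Integration.integrable_sum)
    have "(\<integral>x. (\<Sum>m\<in>I. \<Sum>n\<in>I. indicator (A m \<inter> A n) x) + (E\<^sup>2 - 2 * E * ?S x) \<partial>M)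
      = (\<integral>x. (\<Sum>m\<in>I. \<Sum>n\<in>I. indicator (A m \<inter> A n) x) \<partial>M) + (\<integral>x. (E\<^sup>2 - 2 * E * ?S x) \<partial>M)"
      using int1 int2 by (intro Bochner_Integration.integral_add Bochner_Integration.integrable_diff) auto
    also have "(\<integral>x. (E\<^sup>2 - 2 * E * ?S x) \<partial>M) = E\<^sup>2 - 2 * E * E"
      using int2 by (subst Bochner_Integration.integral_diff) (auto simp: i2 M1)
    finally show ?thesis by (simp only: i1)
  qed
  finally show ?thesis by (simp add: power2_eq_square)
qed

text \<open>On a finite block of total measure E, the hypothesis bounds the second moment by (1 +
  \<delta>) E^2 + (2 C + 1) E, the last E being the diagonal. Divergence allows E so large that the
  linear term is at most \<delta> E^2. The weight \<open>measure M (A n)\<close> on the error is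
  what makes it linear in E: it suffices that the sums of \<open>e m n\<close> over m < n are
  bounded.\<close>

lemma null_complement_of_quasi_independent:
  fixes A :: "nat \<Rightarrow> 'a set"
  assumes M: "finite_measure M" and M1: "measure M (space M) = 1"
    and A: "\<And>n. A n \<in> sets M"
    and div: "\<not> summable (\<lambda>n. measure M (A n))"
    and indep: "\<And>\<delta>::real. \<delta> > 0 \<Longrightarrow> \<exists>C e. (\<forall>m n. (0::real) \<le> e m n) \<and> (\<forall>n. (\<Sum>m<n. e m n) \<le> C) \<and>
       (\<forall>m n. m < n \<longrightarrow> measure M (A m \<inter> A n) \<le> measure M (A n) * ((1 + \<delta>) * measure M (A m) + e m n))"
  shows "measure M (space M - (\<Union>n\<in>{n0..}. A n)) = 0"
proof -
  interpret finite_measure M by fact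
  let ?p = "measure M (space M - (\<Union>n\<in>{n0..}. A n))"
  let ?a = "\<lambda>n. measure M (A n)"
  have "?p \<le> 2 * \<delta>" if \<delta>: "\<delta> > 0" for \<delta>
  proof -
    obtain C e where e0: "\<And>m n. (0::real) \<le> e m n" and eC: "\<And>n. (\<Sum>m<n. e m n) \<le> C"
      and ind: "\<And>m n. m < n \<Longrightarrow> measure M (A m \<inter> A n) \<le> ?a n * ((1 + \<delta>) * ?a m + e m n)"
      using indep[OF \<delta>] by metis
    have C0: "0 \<le> C" using eC[of 0] by simp
    have "\<not> summable (\<lambda>n. ?a (n + n0))" using div summable_iff_shift[of ?a n0] by simp
    then obtain N where N: "(\<Sum>n<N. ?a (n + n0)) > (1 + 2 * C) / \<delta>"
      using bounded_imp_summable[of "\<lambda>n. ?a (n + n0)" "(1 + 2 * C) / \<delta>"] measure_nonneg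
      by (metis lessThan_Suc_atMost not_le)
    define I where "I = {n0..<n0+N}"
    define E where "E = (\<Sum>n\<in>I. ?a n)"
    have "E = (\<Sum>n<N. ?a (n + n0))"
      unfolding E_def I_def by (simp add: sum.shift_bounds_nat_ivl[of ?a 0 n0 N, simplified add.left_neutral] atLeast0LessThan add.commute)
    hence EC: "E > (1 + 2 * C) / \<delta>" using N by simp
    have E0: "E > 0" using EC C0 \<delta> by (smt (verit) divide_nonneg_pos)
    have EC': "1 + 2 * C \<le> \<delta> * E" using EC \<delta> by (simp add: field_simps)
    have fI: "finite I" by (simp add: I_def)
    let ?P = "\<lambda>m n. measure M (A m \<inter> A n)"
    \<comment> \<open>Only pairs m < n are controlled by hypothesis, so the double sum is split at
      the diagonal and one half is folded onto the other by symmetry.\<close>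
    have split: "(\<Sum>m\<in>I. g m n) = (\<Sum>m\<in>{m\<in>I. m < n}. g m n) + g n n + (\<Sum>m\<in>{m\<in>I. n < m}. g m n)"
      if "n \<in> I" for n and g :: "nat \<Rightarrow> nat \<Rightarrow> real"
    proof -
      have "I = {m\<in>I. m < n} \<union> ({n} \<union> {m\<in>I. n < m})" using that by auto
      hence "sum (\<lambda>m. g m n) I = sum (\<lambda>m. g m n) ({m\<in>I. m < n} \<union> ({n} \<union> {m\<in>I. n < m}))" by simp
      also have "\<dots> = (\<Sum>m\<in>{m\<in>I. m < n}. g m n) + (g n n + (\<Sum>m\<in>{m\<in>I. n < m}. g m n))"
        using fI by (subst sum.union_disjoint; (subst sum.union_disjoint)?; auto)
      finally show ?thesis by simp
    qed
    have swap: "(\<Sum>n\<in>I. \<Sum>m\<in>{m\<in>I. n < m}. g m n) = (\<Sum>n\<in>I. \<Sum>m\<in>{m\<in>I. m < n}. g n m)" for g :: "nat \<Rightarrow> nat \<Rightarrow> real"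
      by (rule sum.swap_restrict[OF fI fI])
    let ?T = "\<lambda>g. \<Sum>n\<in>I. \<Sum>m\<in>{m\<in>I. m < n}. g m n :: real"
    have sym: "(\<Sum>n\<in>I. \<Sum>m\<in>I. g m n) = 2 * ?T g + (\<Sum>n\<in>I. g n n)" if "\<And>m n. g m n = g n m" for g
    proof -
      have "(\<Sum>n\<in>I. \<Sum>m\<in>I. g m n) = (\<Sum>n\<in>I. (\<Sum>m\<in>{m\<in>I. m < n}. g m n) + g n n + (\<Sum>m\<in>{m\<in>I. n < m}. g m n))"
        by (intro sum.cong refl split)
      also have "\<dots> = ?T g + (\<Sum>n\<in>I. g n n) + (\<Sum>n\<in>I. \<Sum>m\<in>{m\<in>I. n < m}. g m n)"
        by (simp add: sum.distrib)
      also have "(\<Sum>n\<in>I. \<Sum>m\<in>{m\<in>I. n < m}. g m n) = (\<Sum>n\<in>I. \<Sum>m\<in>{m\<in>I. m < n}. g n m)" by (rule swap)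
      also have "\<dots> = ?T g" by (intro sum.cong refl that)
      finally show ?thesis by simp
    qed
    have "?T ?P \<le> (\<Sum>n\<in>I. \<Sum>m\<in>{m\<in>I. m < n}. ?a n * ((1 + \<delta>) * ?a m + e m n))"
      by (intro sum_mono ind) auto
    also have "\<dots> = (1 + \<delta>) * ?T (\<lambda>m n. ?a m * ?a n) + (\<Sum>n\<in>I. ?a n * (\<Sum>m\<in>{m\<in>I. m < n}. e m n))"
      by (simp add: sum.distrib sum_distrib_left algebra_simps)
    also have "(\<Sum>n\<in>I. ?a n * (\<Sum>m\<in>{m\<in>I. m < n}. e m n)) \<le> (\<Sum>n\<in>I. ?a n * C)"
    proof (intro sum_mono mult_left_mono measure_nonneg)
      fix n
      have "(\<Sum>m\<in>{m\<in>I. m < n}. e m n) \<le> (\<Sum>m<n. e m n)" by (rule sum_mono2) (auto simp: e0)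
      thus "(\<Sum>m\<in>{m\<in>I. m < n}. e m n) \<le> C" using eC[of n] by simp
    qed
    also have "(\<Sum>n\<in>I. ?a n * C) = C * E" by (simp add: E_def sum_distrib_left mult.commute)
    finally have TP: "?T ?P \<le> (1 + \<delta>) * ?T (\<lambda>m n. ?a m * ?a n) + C * E" by simp
    have "E\<^sup>2 = 2 * ?T (\<lambda>m n. ?a m * ?a n) + (\<Sum>n\<in>I. ?a n * ?a n)"
      by (subst sym[symmetric]) (auto simp: E_def power2_eq_square sum_product mult.commute)
    moreover have "(\<Sum>n\<in>I. ?a n * ?a n) \<ge> 0" by (intro sum_nonneg) auto
    ultimately have TA: "2 * ?T (\<lambda>m n. ?a m * ?a n) \<le> E\<^sup>2" by linarith
    have "(\<Sum>m\<in>I. \<Sum>n\<in>I. ?P m n) = (\<Sum>n\<in>I. \<Sum>m\<in>I. ?P m n)" by (rule sum.swap)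
    also have "\<dots> = 2 * ?T ?P + E" by (subst sym) (auto simp: E_def Int_commute)
    also have "\<dots> \<le> (1 + \<delta>) * (2 * ?T (\<lambda>m n. ?a m * ?a n)) + 2 * (C * E) + E" using TP by simp
    also have "\<dots> \<le> (1 + \<delta>) * E\<^sup>2 + 2 * (C * E) + E"
      using mult_left_mono[OF TA, of "1 + \<delta>"] \<delta> by simp
    also have "\<dots> = (1 + \<delta>) * E\<^sup>2 + (1 + 2 * C) * E" by (simp add: algebra_simps)
    also have "\<dots> \<le> (1 + \<delta>) * E\<^sup>2 + \<delta> * E * E" using EC' E0 by (intro add_left_mono mult_right_mono) auto
    finally have "(\<Sum>m\<in>I. \<Sum>n\<in>I. ?P m n) - E\<^sup>2 \<le> 2 * \<delta> * E\<^sup>2" by (simp add: algebra_simps power2_eq_square)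
    with chebyshev_union_complement[OF M M1 A fI E_def]
    have "E\<^sup>2 * measure M (space M - (\<Union>n\<in>I. A n)) \<le> E\<^sup>2 * (2 * \<delta>)" by (simp add: mult.commute)
    hence "measure M (space M - (\<Union>n\<in>I. A n)) \<le> 2 * \<delta>" using E0 by simp
    moreover have "?p \<le> measure M (space M - (\<Union>n\<in>I. A n))"
      using A by (intro finite_measure_mono) (auto simp: I_def)
    ultimately show ?thesis by linarith
  qed
  have "?p \<le> 0"
  proof (rule field_le_epsilon)
    fix \<epsilon> :: real assume "\<epsilon> > 0"
    thus "?p \<le> 0 + \<epsilon>" using \<open>\<And>\<delta>. \<delta> > 0 \<Longrightarrow> ?p \<le> 2 * \<delta>\<close>[of "\<epsilon> / 2"] by simp
  qed
  thus ?thesis using measure_nonneg[of M] by (simp add: order_antisym)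
qed

section \<open>Sums over dyadic tuples\<close>

lemma sum_Un_le:
  fixes f :: "'a \<Rightarrow> real"
  assumes "finite A" "finite B" "\<And>x. 0 \<le> f x"
  shows "sum f (A \<union> B) \<le> sum f A + sum f B"
proof -
  have "sum f (A \<union> B) = sum f A + sum f B - sum f (A \<inter> B)" using assms by (intro sum_Un) auto
  moreover have "sum f (A \<inter> B) \<ge> 0" using assms by (intro sum_nonneg) auto
  ultimately show ?thesis by linarith
qed

lemma sum_UN_le:
  fixes f :: "'a \<Rightarrow> real"
  assumes "finite I" "\<And>i. i \<in> I \<Longrightarrow> finite (B i)" "\<And>x. 0 \<le> f x"
  shows "sum f (\<Union>i\<in>I. B i) \<le> (\<Sum>i\<in>I. sum f (B i))"
  using assms(1,2)
proof (induction I rule: finite_induct)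
  case (insert i I)
  have "sum f (\<Union>i\<in>insert i I. B i) \<le> sum f (B i) + sum f (\<Union>i\<in>I. B i)"
    using insert assms(3) by (simp, intro sum_Un_le) auto
  thus ?case using insert by fastforce
qed simp

lemma sum_dyadic_tuples_le:
  fixes \<phi> :: "'k::finite \<Rightarrow> nat \<Rightarrow> real" and x K :: real and S :: "('k \<Rightarrow> nat) set"
  assumes x: "0 < x" "x \<le> 1" and K: "1 \<le> K" and k: "CARD('k) \<ge> 3"
    and S: "finite S" "\<And>s i. s \<in> S \<Longrightarrow> L \<le> s i"
    and \<phi>0: "\<And>i n. 0 \<le> \<phi> i n"
    and \<phi>1: "\<And>i n. \<phi> i n \<le> (1/2) ^ Suc n + x"
    and \<phi>2: "\<And>i n F. finite F \<Longrightarrow> F \<subseteq> {n..} \<Longrightarrow> sum (\<phi> i) F \<le> (1/2) ^ n + x"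
  shows "(\<Sum>s\<in>S. \<Prod>i\<in>UNIV. \<phi> i (s i)) \<le>
    (1 + 1 / K) ^ CARD('k) * (\<Sum>s\<in>S. \<Prod>i\<in>UNIV. (1/2) ^ Suc (s i)) +
    ((2 * K + 1) ^ CARD('k) + real (CARD('k)\<^sup>2) * 2 ^ CARD('k) * 2 * (2 * K + 1)) * (x ^ 3 + x * (1/2) ^ L)"
proof -
  let ?k = "CARD('k)" and ?h = "(1/2::real) ^ L"
  (* phi i n is the proportion of grid points in the n-th shell.  In a shell that is not bad the
     error x costs a factor 1 + 1/K.  A tuple with a bad entry has either only bad entries, giving x^k, or
     also a good one, whose tail sum gives the factor (1/2)^L. *)
  define bad where "bad n \<longleftrightarrow> (1/2) ^ Suc n < K * x" for n :: nat
  \<comment> \<open>A window {L..M} containing every entry of every tuple in S. The bounds below are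
    uniform in its length, so no logarithm arises.\<close>
  define M where "M = (\<Sum>s\<in>S. \<Sum>i\<in>UNIV. s i)"
  define F where "F = {L..M}"
  have F: "finite F" by (simp add: F_def)
  have SF: "s i \<in> F" if "s \<in> S" for s i
  proof -
    have "s i \<le> (\<Sum>i\<in>UNIV. s i)" by (rule member_le_sum) auto
    also have "\<dots> \<le> M" unfolding M_def using that S(1) by (intro member_le_sum) auto
    finally show ?thesis using S(2)[OF that] by (simp add: F_def)
  qed
  define f where "f s = (\<Prod>i\<in>UNIV. \<phi> i (s i))" for s
  have f0: "0 \<le> f s" for s unfolding f_def by (intro prod_nonneg ballI \<phi>0)
  have h01: "0 < ?h" "?h \<le> 1" by (auto intro: power_le_one)
  have P: "sum (\<phi> i) {n\<in>F. bad n} \<le> (2 * K + 1) * x" for i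
  proof (cases "{n\<in>F. bad n} = {}")
    case True
    hence "sum (\<phi> i) {n\<in>F. bad n} = 0" by (simp only: sum.empty)
    moreover have "0 \<le> (2 * K + 1) * x" using x K by simp
    ultimately show ?thesis by linarith
  next
    case False
    then obtain n where "bad n" by auto
    \<comment> \<open>All bad entries lie in the tail from \<open>n0\<close>, where the tail bound
      gives 2^-n0 + x. As \<open>n0\<close> itself is bad, 2^-n0 < 2 K x, whence the constant 2 K +
      1.\<close>
    define n0 where "n0 = (LEAST n. bad n)"
    have "bad n0" unfolding n0_def using \<open>bad n\<close> by (rule LeastI)
    moreover have "{n\<in>F. bad n} \<subseteq> {n0..}" unfolding n0_def by (auto intro: Least_le)
    hence "sum (\<phi> i) {n\<in>F. bad n} \<le> (1/2) ^ n0 + x" using F by (intro \<phi>2) auto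
    ultimately show ?thesis by (simp add: bad_def algebra_simps)
  qed
  have Q: "sum (\<phi> i) {n\<in>F. \<not> bad n} \<le> 2 * ?h" for i
  proof (cases "{n\<in>F. \<not> bad n} = {}")
    case True
    hence "sum (\<phi> i) {n\<in>F. \<not> bad n} = 0" by (simp only: sum.empty)
    thus ?thesis using h01 by linarith
  next
    case False
    then obtain n where n: "n \<ge> L" "K * x \<le> (1/2) ^ Suc n" by (auto simp: F_def bad_def)
    \<comment> \<open>A single good entry n >= L already forces x <= 2^-L, so the tail bound 2^-L +
      x is at most twice 2^-L.\<close>
    have "x \<le> K * x" using x K by simp
    also have "\<dots> \<le> (1/2) ^ Suc n" by (rule n)
    also have "\<dots> \<le> ?h" using n by (intro power_decreasing) auto
    finally have "x \<le> ?h" .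
    moreover have "sum (\<phi> i) {n\<in>F. \<not> bad n} \<le> ?h + x" by (intro \<phi>2) (auto simp: F_def)
    ultimately show ?thesis by simp
  qed
  have T: "sum (\<phi> i) F \<le> 2" for i
  proof -
    have "sum (\<phi> i) F \<le> ?h + x" by (intro \<phi>2) (auto simp: F_def)
    thus ?thesis using x h01 by linarith
  qed
  define G where "G = {s\<in>S. \<forall>i. \<not> bad (s i)}"
  define A where "A = PiE (UNIV :: 'k set) (\<lambda>_. {n\<in>F. bad n})"
  \<comment> \<open>\<open>B p\<close> enlarges the mixed tuples to a product set, over which the
    sum factors: the first index of p has a bad entry, the second a good one, and the free remaining
    ones cost at most 2 each. There are at most k^2 pairs p.\<close>
  define B where "B p = PiE (UNIV :: 'k set) (\<lambda>l. if l = fst p then {n\<in>F. bad n} else if l = snd p then {n\<in>F. \<not> bad n} else F)" for p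
  define I where "I = {p :: 'k \<times> 'k. fst p \<noteq> snd p}"
  have finI: "finite I" by simp
  have finA: "finite A" using F by (auto simp: A_def intro!: finite_PiE)
  have finB: "finite (B p)" for p using F by (auto simp: B_def intro!: finite_PiE)
  have finG: "finite G" using S by (auto simp: G_def)
  have sub: "S \<subseteq> G \<union> (A \<union> (\<Union>p\<in>I. B p))"
  proof
    fix s assume s: "s \<in> S"
    consider "\<forall>i. \<not> bad (s i)" | "\<forall>i. bad (s i)" | i j where "bad (s i)" "\<not> bad (s j)" by blast
    thus "s \<in> G \<union> (A \<union> (\<Union>p\<in>I. B p))"
    proof cases
      case 1 thus ?thesis using s by (simp add: G_def)
    next
      case 2 thus ?thesis using SF[OF s] by (auto simp: A_def)
    next
      case 3
      hence "i \<noteq> j" by auto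
      hence "(i, j) \<in> I" "s \<in> B (i, j)" using 3 SF[OF s] by (auto simp: I_def B_def PiE_iff)
      thus ?thesis by blast
    qed
  qed
  have G_le: "sum f G \<le> (1 + 1 / K) ^ ?k * (\<Sum>s\<in>S. \<Prod>i\<in>UNIV. (1/2) ^ Suc (s i))"
  proof -
    have "sum f G \<le> (\<Sum>s\<in>G. (1 + 1 / K) ^ ?k * (\<Prod>i\<in>UNIV. (1/2) ^ Suc (s i)))"
    proof (rule sum_mono)
      fix s assume s: "s \<in> G"
      have "f s \<le> (\<Prod>i\<in>UNIV. (1 + 1 / K) * (1/2) ^ Suc (s i))"
        unfolding f_def
      proof (intro prod_mono conjI \<phi>0)
        fix i
        have "K * x \<le> (1/2) ^ Suc (s i)" using s by (simp add: G_def bad_def not_less del: power_Suc)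
        hence "x \<le> 1 / K * (1/2) ^ Suc (s i)" using K by (simp add: field_simps)
        thus "\<phi> i (s i) \<le> (1 + 1 / K) * (1/2) ^ Suc (s i)" using \<phi>1[of i "s i"]
          by (simp add: distrib_right)
      qed
      also have "\<dots> = (1 + 1 / K) ^ ?k * (\<Prod>i\<in>UNIV. (1/2) ^ Suc (s i))"
        by (simp only: prod.distrib prod_constant)
      finally show "f s \<le> (1 + 1 / K) ^ ?k * (\<Prod>i\<in>UNIV. (1/2) ^ Suc (s i))" .
    qed
    also have "\<dots> \<le> (\<Sum>s\<in>S. (1 + 1 / K) ^ ?k * (\<Prod>i\<in>UNIV. (1/2) ^ Suc (s i)))"
      using K S(1) by (intro sum_mono2 mult_nonneg_nonneg prod_nonneg) (auto simp: G_def)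
    finally show ?thesis by (simp only: sum_distrib_left)
  qed
  have A_le: "sum f A \<le> (2 * K + 1) ^ ?k * x ^ 3"
  proof -
    have "sum f A = (\<Prod>i\<in>UNIV. sum (\<phi> i) {n\<in>F. bad n})"
      unfolding A_def f_def using F by (subst prod_sum_PiE) auto
    also have "\<dots> \<le> (\<Prod>i\<in>(UNIV::'k set). (2 * K + 1) * x)"
      by (intro prod_mono conjI P sum_nonneg \<phi>0)
    also have "\<dots> = (2 * K + 1) ^ ?k * x ^ ?k" by (simp add: power_mult_distrib)
    also have "\<dots> \<le> (2 * K + 1) ^ ?k * x ^ 3"
      using x k K by (intro mult_left_mono power_decreasing) auto
    finally show ?thesis .
  qed
  have B_le: "sum f (B p) \<le> 2 ^ ?k * 2 * (2 * K + 1) * (x * ?h)" if p: "p \<in> I" for p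
  proof -
    obtain i j where ij: "p = (i, j)" "i \<noteq> j" using p by (cases p) (auto simp: I_def)
    define w where "w l = (if l = i then (2 * K + 1) * x else if l = j then 2 * ?h else 2)" for l
    have "sum f (B p) = (\<Prod>l\<in>UNIV. sum (\<phi> l) (if l = i then {n\<in>F. bad n} else if l = j then {n\<in>F. \<not> bad n} else F))"
      unfolding B_def f_def ij fst_conv snd_conv using F by (subst prod_sum_PiE) auto
    also have "\<dots> \<le> (\<Prod>l\<in>UNIV. w l)"
      using P Q T by (intro prod_mono conjI sum_nonneg \<phi>0) (auto simp: w_def)
    also have "\<dots> = w i * (w j * (\<Prod>l\<in>UNIV - {i} - {j}. w l))"
      using ij by (subst prod.remove[of UNIV i], simp, simp) (subst prod.remove[of "UNIV - {i}" j], auto)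
    also have "(\<Prod>l\<in>UNIV - {i} - {j}. w l) = (\<Prod>l\<in>UNIV - {i} - {j}. 2)"
      by (intro prod.cong) (auto simp: w_def)
    also have "\<dots> = 2 ^ card (UNIV - {i} - {j})" by simp
    also have "w i * (w j * 2 ^ card (UNIV - {i} - {j})) \<le> w i * (w j * 2 ^ ?k)"
      using x K h01 by (intro mult_left_mono power_increasing card_mono) (auto simp: w_def)
    also have "\<dots> = 2 ^ ?k * 2 * (2 * K + 1) * (x * ?h)" using ij by (simp add: w_def)
    finally show ?thesis .
  qed
  have cardI: "card I \<le> ?k\<^sup>2"
  proof -
    have "card I \<le> card (UNIV :: ('k \<times> 'k) set)" by (rule card_mono) auto
    also have "\<dots> = ?k\<^sup>2" by (simp add: power2_eq_square card_cartesian_product flip: UNIV_Times_UNIV)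
    finally show ?thesis .
  qed
  let ?c = "2 ^ ?k * 2 * (2 * K + 1) :: real"
  have c0: "?c \<ge> 0" using K by simp
  have "sum f S \<le> sum f (G \<union> (A \<union> (\<Union>p\<in>I. B p)))"
    using finA finB finG f0 by (intro sum_mono2 sub) auto
  also have "\<dots> \<le> sum f G + sum f (A \<union> (\<Union>p\<in>I. B p))"
    using finA finB finG f0 by (intro sum_Un_le) auto
  also have "sum f (A \<union> (\<Union>p\<in>I. B p)) \<le> sum f A + sum f (\<Union>p\<in>I. B p)"
    using finA finB finG f0 by (intro sum_Un_le) auto
  also have "sum f (\<Union>p\<in>I. B p) \<le> (\<Sum>p\<in>I. sum f (B p))"
    using finB f0 by (intro sum_UN_le) auto
  also have "\<dots> \<le> (\<Sum>p\<in>I. ?c * (x * ?h))" by (intro sum_mono B_le)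
  also have "\<dots> = real (card I) * (?c * (x * ?h))" by simp
  also have "\<dots> \<le> real (?k\<^sup>2) * (?c * (x * ?h))"
  proof (rule mult_right_mono)
    show "real (card I) \<le> real (?k\<^sup>2)" using cardI by (simp only: of_nat_le_iff)
    show "0 \<le> ?c * (x * ?h)" using x h01 by (intro mult_nonneg_nonneg[OF c0]) auto
  qed
  finally have "sum f S \<le> sum f G + (sum f A + real (?k\<^sup>2) * (?c * (x * ?h)))" by simp
  also have "\<dots> \<le> (1 + 1 / K) ^ ?k * (\<Sum>s\<in>S. \<Prod>i\<in>UNIV. (1/2) ^ Suc (s i)) +
     ((2 * K + 1) ^ ?k * x ^ 3 + real (?k\<^sup>2) * (?c * (x * ?h)))"
    by (intro add_mono G_le A_le order_refl)
  also have "(2 * K + 1) ^ ?k * x ^ 3 + real (?k\<^sup>2) * (?c * (x * ?h)) \<le>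
      ((2 * K + 1) ^ ?k + real (?k\<^sup>2) * ?c) * (x ^ 3 + x * ?h)"
  proof -
    have "0 \<le> (2 * K + 1) ^ ?k * (x * ?h)" "0 \<le> real (?k\<^sup>2) * ?c * x ^ 3"
      using K x h01 c0 by (intro mult_nonneg_nonneg; simp)+
    thus ?thesis by (simp only: distrib_left distrib_right mult.assoc)
  qed
  finally show ?thesis by (simp add: f_def mult.assoc)
qed

section \<open>Divisor sums\<close>

text \<open>A divisor of n is determined by its multiplicities at the primes dividing n, and these
  are at most those of n.\<close>

lemma card_divisors_le_prod:
  fixes n :: nat
  assumes n: "n > 0"
  shows "card {d. d dvd n} \<le> (\<Prod>p\<in>prime_factors n. multiplicity p n + 1)"
proof -
  let ?P = "prime_factors n"
  let ?f = "\<lambda>d. restrict (\<lambda>p. multiplicity p d) ?P"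
  have "card {d. d dvd n} \<le> card (\<Pi>\<^sub>E p\<in>?P. {..multiplicity p n})"
  proof (rule card_inj_on_le)
    show "?f ` {d. d dvd n} \<subseteq> (\<Pi>\<^sub>E p\<in>?P. {..multiplicity p n})"
      using n by (auto simp: dvd_imp_multiplicity_le)
    show "finite (\<Pi>\<^sub>E p\<in>?P. {..multiplicity p n})" by (auto intro: finite_PiE)
    show "inj_on ?f {d. d dvd n}"
    proof (rule inj_onI)
      fix c d assume c: "c \<in> {d. d dvd n}" and d: "d \<in> {d. d dvd n}" and eq: "?f c = ?f d"
      have "multiplicity p c = multiplicity p d" if p: "prime p" for p
      proof (cases "p \<in> ?P")
        case True
        thus ?thesis using fun_cong[OF eq, of p] by simp
      next
        case False
        hence "\<not> p dvd n" using p n by (auto simp: prime_factors_dvd)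
        hence "\<not> p dvd c" "\<not> p dvd d" using c d by (auto dest: dvd_trans)
        thus ?thesis by (simp add: not_dvd_imp_multiplicity_0)
      qed
      moreover have "c \<noteq> 0" "d \<noteq> 0" using c d n by auto
      ultimately show "c = d" using multiplicity_eq_imp_eq[of c d] by simp
    qed
  qed
  also have "\<dots> = (\<Prod>p\<in>?P. multiplicity p n + 1)" by (simp add: card_PiE)
  finally show ?thesis .
qed

text \<open>Prime by prime, a + 1 is compared with p^(a \<eta>). For p >= 2^(1/\<eta>) one has p^(a
  \<eta>) >= 2^a >= a + 1 without loss; each of the at most N smaller primes loses a factor B, so
  B^N is an admissible constant.\<close>

lemma card_divisors_bound:
  fixes \<eta> :: real
  assumes \<eta>: "\<eta> > 0"
  shows "\<exists>C>0. \<forall>n>0. real (card {d. d dvd n}) \<le> C * real n powr \<eta>"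
proof -
  \<comment> \<open>Chosen so that a + 1 <= B (1 + a \<eta> ln 2) for all a; then 1 + x <= exp x
    gives a + 1 <= B 2^(a \<eta>).\<close>
  define B where "B = 1 + 1 / (\<eta> * ln 2)"
  define N where "N = nat \<lceil>2 powr (1 / \<eta>)\<rceil>"
  have l: "\<eta> * ln 2 > 0" using \<eta> by simp
  have B1: "B \<ge> 1" using l by (simp add: B_def)
  have Ba: "real a + 1 \<le> B * 2 powr (real a * \<eta>)" for a :: nat
  proof -
    have "B * (1 + real a * (\<eta> * ln 2)) = 1 + real a + real a * (\<eta> * ln 2) + 1 / (\<eta> * ln 2)"
      using \<eta> by (simp add: B_def distrib_left distrib_right)
    moreover have "0 \<le> real a * (\<eta> * ln 2)" "0 \<le> 1 / (\<eta> * ln 2)" using l by simp_all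
    ultimately have "real a + 1 \<le> B * (1 + real a * (\<eta> * ln 2))" by linarith
    also have "\<dots> \<le> B * exp (real a * (\<eta> * ln 2))" using B1 by (intro mult_left_mono exp_ge_add_one_self) auto
    finally show ?thesis by (simp add: powr_def mult_ac)
  qed
  have "real (card {d. d dvd n}) \<le> B ^ N * real n powr \<eta>" if n: "n > 0" for n :: nat
  proof -
    let ?P = "prime_factors n" and ?a = "\<lambda>p. multiplicity p n"
    have fac: "real (?a p + 1) \<le> (if p < N then B else 1) * (real p powr (real (?a p) * \<eta>))" if p: "p \<in> ?P" for p
    proof -
      have p2: "real p \<ge> 2" using p prime_ge_2_nat by auto
      show ?thesis
      proof (cases "p < N")
        case True
        have "2 powr (real (?a p) * \<eta>) \<le> real p powr (real (?a p) * \<eta>)"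
          using p2 \<eta> by (intro powr_mono2) auto
        hence "B * 2 powr (real (?a p) * \<eta>) \<le> B * real p powr (real (?a p) * \<eta>)"
          using B1 by (intro mult_left_mono) auto
        thus ?thesis using Ba[of "?a p"] True by simp
      next
        case False
        hence "2 powr (1 / \<eta>) \<le> real p" unfolding N_def by linarith
        hence "(2 powr (1 / \<eta>)) powr (real (?a p) * \<eta>) \<le> real p powr (real (?a p) * \<eta>)"
          using \<eta> by (intro powr_mono2) auto
        hence "2 ^ ?a p \<le> real p powr (real (?a p) * \<eta>)" using \<eta> by (simp add: powr_powr powr_realpow)
        moreover have "real (?a p + 1) \<le> 2 ^ ?a p"
          using less_exp[of "?a p"] by (metis Suc_eq_plus1 Suc_leI of_nat_le_iff of_nat_numeral of_nat_power)
        ultimately show ?thesis using False by simp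
      qed
    qed
    have "real (card {d. d dvd n}) \<le> real (\<Prod>p\<in>?P. ?a p + 1)"
      using card_divisors_le_prod[OF n] by (simp only: of_nat_le_iff)
    also have "\<dots> = (\<Prod>p\<in>?P. real (?a p + 1))" by (rule of_nat_prod)
    also have "\<dots> \<le> (\<Prod>p\<in>?P. (if p < N then B else 1) * (real p powr (real (?a p) * \<eta>)))"
      by (intro prod_mono conjI fac) auto
    also have "\<dots> = (\<Prod>p\<in>?P. if p < N then B else 1) * (\<Prod>p\<in>?P. real p powr (real (?a p) * \<eta>))"
      by (rule prod.distrib)
    also have "(\<Prod>p\<in>?P. real p powr (real (?a p) * \<eta>)) = (\<Prod>p\<in>?P. (real p ^ ?a p) powr \<eta>)"
    proof (intro prod.cong refl)
      fix p assume "p \<in> ?P"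
      hence "real p > 0" by (auto intro: prime_gt_0_nat)
      thus "real p powr (real (?a p) * \<eta>) = (real p ^ ?a p) powr \<eta>"
        by (simp add: powr_powr flip: powr_realpow)
    qed
    also have "\<dots> = (\<Prod>p\<in>?P. real p ^ ?a p) powr \<eta>"
      by (rule prod_powr_distrib[symmetric])
    also have "(\<Prod>p\<in>?P. real p ^ ?a p) = real (\<Prod>p\<in>?P. p ^ ?a p)" by simp
    also have "(\<Prod>p\<in>?P. p ^ ?a p) = n" using prime_factorization_nat[of n] n by simp
    also have "(\<Prod>p\<in>?P. if p < N then B else 1) = B ^ card {p\<in>?P. p < N}"
      by (simp add: prod.If_cases Int_def)
    also have "\<dots> \<le> B ^ N"
    proof (rule power_increasing[OF _ B1])
      have "card {p\<in>?P. p < N} \<le> card {..<N}" by (rule card_mono) auto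
      thus "card {p\<in>?P. p < N} \<le> N" by simp
    qed
    finally show ?thesis by (simp add: mult_right_mono)
  qed
  moreover have "B ^ N > 0" using B1 by simp
  ultimately show ?thesis by blast
qed

text \<open>Every m is j (n / r) with r = n / gcd m n and j = m / gcd m n <= r, and gcd m n / n =
  1/r. Dropping the coprimality of j and r only adds nonnegative terms.\<close>

lemma sum_gcd_le_sum_divisors:
  fixes g :: "real \<Rightarrow> nat \<Rightarrow> real"
  assumes n: "n > 0" and g: "\<And>r m. g r m \<ge> 0"
  shows "(\<Sum>m\<in>{1..<n}. g (real (gcd m n) / real n) m)
     \<le> (\<Sum>r | r dvd n. \<Sum>j\<in>{1..r}. g (1 / real r) (j * (n div r)))"
proof -
  have fin: "finite {r. r dvd n}" using n by simp
  have "(\<Sum>m\<in>{1..<n}. g (real (gcd m n) / real n) m)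
     \<le> (\<Sum>(r, j)\<in>(SIGMA r:{r. r dvd n}. {1..r}). g (1 / real r) (j * (n div r)))"
  proof (rule sum_le_included[where i = "\<lambda>(r, j). j * (n div r)"])
    show "\<forall>m\<in>{1..<n}. \<exists>y\<in>(SIGMA r:{r. r dvd n}. {1..r}). (case y of (r, j) \<Rightarrow> j * (n div r)) = m \<and>
        g (real (gcd m n) / real n) m \<le> (case y of (r, j) \<Rightarrow> g (1 / real r) (j * (n div r)))"
    proof
      fix m assume m: "m \<in> {1..<n}"
      let ?d = "gcd m n" let ?r = "n div ?d" let ?j = "m div ?d"
      have d0: "?d > 0" using n by simp
      have nr: "n div ?r = ?d" using n by (metis dvd_div_mult_self dvd_div_eq_0_iff gcd_dvd2 less_numeral_extra(3) nonzero_mult_div_cancel_left)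
      have rn: "?r dvd n" by (metis dvd_div_mult_self dvd_triv_left gcd_dvd2)
      have jm: "?j * ?d = m" by simp
      have "?j \<noteq> 0"
      proof
        assume "?j = 0"
        with jm have "m = 0" by (metis mult_0)
        with m show False by simp
      qed
      hence "?j \<ge> 1" by linarith
      moreover have "?j \<le> ?r" using m by (intro div_le_mono) auto
      moreover have "real ?d / real n = 1 / real ?r" using n d0 by (simp add: real_of_nat_div)
      ultimately show "\<exists>y\<in>(SIGMA r:{r. r dvd n}. {1..r}). (case y of (r, j) \<Rightarrow> j * (n div r)) = m \<and>
        g (real (gcd m n) / real n) m \<le> (case y of (r, j) \<Rightarrow> g (1 / real r) (j * (n div r)))"
        using nr jm by (intro bexI[of _ "(?r, ?j)"]) (auto simp: rn)
    qed
  qed (use fin g in auto)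
  also have "\<dots> = (\<Sum>r | r dvd n. \<Sum>j\<in>{1..r}. g (1 / real r) (j * (n div r)))"
    using fin by (subst sum.Sigma) auto
  finally show ?thesis .
qed

lemma sum_inverse_squares_le: "(\<Sum>r\<in>{1..n}. 1 / (real r)\<^sup>2) \<le> 2"
proof (cases "n = 0")
  case False
  hence "n \<ge> 1" by simp
  hence "(\<Sum>r\<in>{1..n}. 1 / (real r)\<^sup>2) \<le> 2 - 1 / real n"
  proof (induction n rule: dec_induct)
    case (step n)
    have "1 / (real (Suc n))\<^sup>2 \<le> 1 / real n - 1 / real (Suc n)"
    proof -
      have "1 / real n - 1 / real (Suc n) = 1 / (real n * real (Suc n))" using step by (simp add: field_simps)
      moreover have "1 / (real (Suc n))\<^sup>2 \<le> 1 / (real n * real (Suc n))"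
        using step by (intro divide_left_mono) (auto simp: power2_eq_square intro!: mult_right_mono)
      ultimately show ?thesis by linarith
    qed
    thus ?case using step by simp
  qed simp
  thus ?thesis by (smt (verit) divide_nonneg_nonneg of_nat_0_le_iff)
qed simp

lemma sum_inverse_sqrt_le: "(\<Sum>j\<in>{1..r}. 1 / sqrt (real j)) \<le> 2 * sqrt (real r)"
proof (induction r)
  case (Suc r)
  have "1 / sqrt (real (Suc r)) \<le> 2 * sqrt (real (Suc r)) - 2 * sqrt (real r)"
  proof -
    let ?a = "sqrt (real (Suc r))" and ?b = "sqrt (real r)"
    have "?a\<^sup>2 - ?b\<^sup>2 = 1" by simp
    moreover have "0 \<le> (?a - ?b)\<^sup>2" by simp
    ultimately have "1 \<le> (2 * ?a - 2 * ?b) * ?a" by (simp add: power2_eq_square algebra_simps)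
    thus ?thesis by (simp add: divide_le_eq)
  qed
  thus ?case using Suc by simp
qed simp

text \<open>The values of m are grouped by r = n / gcd m n. For the cubes, the r values of j leave
  the sum of r^-2 over the divisors of n. In the second sum, (r/j)^\<eta> <= (r/j)^(1/2) since j <=
  r and \<eta> <= 1/2, and the sum of j^(-1/2) is at most 2 sqrt r; so each r contributes at most 2
  n^-\<eta>, and the number of divisors is at most C n^\<eta> with the same \<eta>.\<close>

lemma sum_gcd_bound:
  fixes \<eta> :: real
  assumes \<eta>: "0 < \<eta>" "\<eta> \<le> 1/2"
  shows "\<exists>C>0. \<forall>n>0. (\<Sum>m\<in>{1..<n}. (real (gcd m n) / real n) ^ 3) \<le> C \<and>
     (\<Sum>m\<in>{1..<n}. real (gcd m n) / real n * real m powr - \<eta>) \<le> C"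
proof -
  obtain C where C: "C > 0" "\<And>n. n > 0 \<Longrightarrow> real (card {d. d dvd n}) \<le> C * real n powr \<eta>"
    using card_divisors_bound[OF \<eta>(1)] by blast
  have "(\<Sum>m\<in>{1..<n}. (real (gcd m n) / real n) ^ 3) \<le> 2" if n: "n > 0" for n
  proof -
    \<comment> \<open>The absolute value makes the summand nonnegative for every real argument, as
      the grouping lemma demands.\<close>
    have "(\<Sum>m\<in>{1..<n}. (real (gcd m n) / real n) ^ 3) \<le> (\<Sum>m\<in>{1..<n}. \<bar>real (gcd m n) / real n\<bar> ^ 3)"
      by simp
    also have "\<dots> \<le> (\<Sum>r | r dvd n. \<Sum>j\<in>{1..r}. \<bar>1 / real r\<bar> ^ 3)"
      by (rule sum_gcd_le_sum_divisors[OF n, where g = "\<lambda>x m. \<bar>x\<bar> ^ 3"]) simp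
    also have "\<dots> = (\<Sum>r | r dvd n. 1 / (real r)\<^sup>2)"
      by (intro sum.cong refl) (simp add: power2_eq_square power3_eq_cube)
    also have "\<dots> \<le> (\<Sum>r\<in>{1..n}. 1 / (real r)\<^sup>2)"
      using n by (intro sum_mono2) (auto intro: Suc_leI dvd_pos_nat dvd_imp_le)
    also have "\<dots> \<le> 2" by (rule sum_inverse_squares_le)
    finally show ?thesis .
  qed
  moreover have "(\<Sum>m\<in>{1..<n}. real (gcd m n) / real n * real m powr - \<eta>) \<le> 2 * C" if n: "n > 0" for n
  proof -
    have "(\<Sum>m\<in>{1..<n}. real (gcd m n) / real n * real m powr - \<eta>)
      \<le> (\<Sum>m\<in>{1..<n}. \<bar>real (gcd m n) / real n\<bar> * real m powr - \<eta>)" by simp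
    also have "\<dots> \<le> (\<Sum>r | r dvd n. \<Sum>j\<in>{1..r}. \<bar>1 / real r\<bar> * real (j * (n div r)) powr - \<eta>)"
      by (rule sum_gcd_le_sum_divisors[OF n, where g = "\<lambda>x m. \<bar>x\<bar> * real m powr - \<eta>"]) simp
    also have "\<dots> \<le> (\<Sum>r | r dvd n. 2 * real n powr - \<eta>)"
    proof (rule sum_mono)
      fix r assume "r \<in> {r. r dvd n}"
      hence r: "r dvd n" "r > 0" using n by (auto intro: dvd_pos_nat)
      have "(\<Sum>j\<in>{1..r}. \<bar>1 / real r\<bar> * real (j * (n div r)) powr - \<eta>)
        \<le> (\<Sum>j\<in>{1..r}. real n powr - \<eta> / sqrt (real r) * (1 / sqrt (real j)))"
      proof (rule sum_mono)
        fix j assume j: "j \<in> {1..r}"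
        have "real (j * (n div r)) = real n / (real r / real j)"
          using r j by (simp add: real_of_nat_div)
        hence "real (j * (n div r)) powr - \<eta> = real n powr - \<eta> * (real r / real j) powr \<eta>"
          by (simp only: powr_divide powr_minus of_nat_0_le_iff divide_nonneg_nonneg) (simp add: divide_inverse)
        also have "\<dots> \<le> real n powr - \<eta> * (real r / real j) powr (1/2)"
          using j \<eta> by (intro mult_left_mono powr_mono) auto
        also have "(real r / real j) powr (1/2) = sqrt (real r) / sqrt (real j)"
          using r j by (simp add: powr_half_sqrt real_sqrt_divide)
        finally have "\<bar>1 / real r\<bar> * real (j * (n div r)) powr - \<eta> \<le> \<bar>1 / real r\<bar> * (real n powr - \<eta> * (sqrt (real r) / sqrt (real j)))"
          by (rule mult_left_mono) simp
        also have "\<dots> = real n powr - \<eta> * (sqrt (real r) / real r) * (1 / sqrt (real j))" by simp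
        also have "sqrt (real r) / real r = 1 / sqrt (real r)"
          using r by (simp add: frac_eq_eq)
        also have "real n powr - \<eta> * (1 / sqrt (real r)) * (1 / sqrt (real j)) = real n powr - \<eta> / sqrt (real r) * (1 / sqrt (real j))" by simp
        finally show "\<bar>1 / real r\<bar> * real (j * (n div r)) powr - \<eta> \<le> real n powr - \<eta> / sqrt (real r) * (1 / sqrt (real j))" .
      qed
      also have "\<dots> = real n powr - \<eta> / sqrt (real r) * (\<Sum>j\<in>{1..r}. 1 / sqrt (real j))"
        by (rule sum_distrib_left[symmetric])
      also have "\<dots> \<le> real n powr - \<eta> / sqrt (real r) * (2 * sqrt (real r))"
        by (intro mult_left_mono sum_inverse_sqrt_le) auto
      also have "\<dots> = 2 * real n powr - \<eta>" using r by simp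
      finally show "(\<Sum>j\<in>{1..r}. \<bar>1 / real r\<bar> * real (j * (n div r)) powr - \<eta>) \<le> 2 * real n powr - \<eta>" .
    qed
    also have "\<dots> = 2 * real n powr - \<eta> * real (card {d. d dvd n})" by simp
    also have "\<dots> \<le> 2 * real n powr - \<eta> * (C * real n powr \<eta>)" by (intro mult_left_mono C n) auto
    also have "\<dots> = 2 * C" using n by (simp add: powr_minus)
    finally show ?thesis .
  qed
  ultimately show ?thesis using C(1)
    by (intro exI[of _ "2 + 2 * C"]) (smt (verit))
qed

section \<open>Dyadic shells\<close>

text \<open>Half-open arcs make shells with different exponents disjoint, and in one coordinate the
  arcs with exponent at least a fill (0, 2^-a).\<close>

definition shell :: "nat \<Rightarrow> real ^ 'k \<Rightarrow> ('k \<Rightarrow> nat) \<Rightarrow> (real ^ 'k) set" where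
  "shell m y s = {x. \<forall>i. x $ i \<in> hits m (y $ i) ((1/2) ^ Suc (s i)) ((1/2) ^ s i)}"

definition shells :: "nat \<Rightarrow> real ^ 'k \<Rightarrow> ('k \<Rightarrow> nat) set \<Rightarrow> (real ^ 'k) set" where
  "shells m y S = (\<Union>s\<in>S. shell m y s)"

definition unit_cube :: "(real ^ 'k) set" where
  "unit_cube = {x. \<forall>i. x $ i \<in> {0..<1}}"

lemma borel_unit_cube [measurable]: "(unit_cube :: (real ^ 'k::finite) set) \<in> sets borel"
  unfolding unit_cube_def by (rule borel_vec_box) auto

lemma measure_unit_cube: "emeasure lborel (unit_cube :: (real ^ 'k::finite) set) = 1"
  unfolding unit_cube_def by (subst emeasure_lborel_vec_prod) auto

lemma emeasure_cube_subset_finite: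
  assumes "A \<subseteq> (unit_cube :: (real ^ 'k::finite) set)" shows "emeasure lborel A \<noteq> \<infinity>"
proof -
  have "emeasure lborel A \<le> emeasure lborel (unit_cube :: (real ^ 'k) set)"
    using assms by (rule emeasure_mono) simp
  also have "\<dots> < \<infinity>" by (simp add: measure_unit_cube)
  finally show ?thesis by simp
qed

lemma borel_shell [measurable]: "shell m y (s :: 'k::finite \<Rightarrow> nat) \<in> sets borel"
  unfolding shell_def by (rule borel_vec_box) simp

lemma shell_subset: "shell m y s \<subseteq> unit_cube"
  using hits_subset unfolding shell_def unit_cube_def by blast

lemma borel_shells: "finite S \<Longrightarrow> shells m y (S :: ('k::finite \<Rightarrow> nat) set) \<in> sets borel"
  unfolding shells_def by (intro sets.finite_UN) auto

lemma shells_subset: "shells m y S \<subseteq> unit_cube"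
  using shell_subset unfolding shells_def by blast

lemma half_power_bounds: "0 < (1/2::real) ^ n" "(1/2::real) ^ n \<le> 1" "(1/2::real) ^ Suc n \<le> (1/2) ^ n"
  by (auto intro: power_le_one)

lemma measure_shell:
  fixes s :: "'k::finite \<Rightarrow> nat"
  assumes "m > 0"
  shows "measure lborel (shell m y s) = (\<Prod>i\<in>UNIV. (1/2) ^ Suc (s i))"
proof -
  have "measure lborel (hits m (y $ i) ((1/2) ^ Suc (s i)) ((1/2) ^ s i)) = (1/2) ^ Suc (s i)" for i
    using half_power_bounds by (subst measure_hits[OF assms]) auto
  moreover have "measure lborel (shell m y s) =
      (\<Prod>i\<in>UNIV. measure lborel (hits m (y $ i) ((1/2) ^ Suc (s i)) ((1/2) ^ s i)))"
    unfolding shell_def by (rule measure_lborel_vec_prod) simp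
  ultimately show ?thesis by (simp only:)
qed

lemma hits_dyadic_disjoint:
  assumes "a \<noteq> b"
  shows "hits m y ((1/2) ^ Suc a) ((1/2) ^ a) \<inter> hits m y ((1/2) ^ Suc b) ((1/2) ^ b) = {}"
proof -
  have "hits m y ((1/2) ^ Suc a) ((1/2) ^ a) \<inter> hits m y ((1/2) ^ Suc b) ((1/2) ^ b) = {}" if "a < b" for a b
  proof -
    have "(1/2::real) ^ b \<le> (1/2) ^ Suc a" using that by (intro power_decreasing) auto
    thus ?thesis unfolding hits_def by fastforce
  qed
  thus ?thesis using assms by (metis Int_commute linorder_neqE_nat)
qed

lemma shell_disjoint:
  assumes "s \<noteq> t" shows "shell m y s \<inter> shell m y t = {}"
proof -
  obtain i where "s i \<noteq> t i" using assms by auto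
  from hits_dyadic_disjoint[OF this] show ?thesis unfolding shell_def by blast
qed

lemma measure_shells:
  fixes S :: "('k::finite \<Rightarrow> nat) set"
  assumes "m > 0" "finite S"
  shows "measure lborel (shells m y S) = (\<Sum>s\<in>S. \<Prod>i\<in>UNIV. (1/2) ^ Suc (s i))"
proof -
  have "measure lborel (shells m y S) = (\<Sum>s\<in>S. measure lborel (shell m y s))"
    unfolding shells_def
    by (rule measure_finite_Union[OF assms(2)])
       (auto simp: disjoint_family_on_def shell_disjoint intro!: emeasure_cube_subset_finite[OF shell_subset, simplified])
  thus ?thesis by (simp only: measure_shell[OF assms(1)])
qed

text \<open>Everything is conditioned on one shell t of index n. Dividing by its measure leaves, in
  each coordinate, the proportion of it lying in a shell of index m, to which the tuple estimate
  applies with x = gcd m n / n. The bound is independent of t, so summing over t restores the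
  measure of \<open>shells n y T\<close> as an exact factor, also in front of the error.\<close>

lemma measure_shells_Int_le:
  fixes S T :: "('k::finite \<Rightarrow> nat) set"
  assumes m: "m > 0" and n: "n > 0" and K: "1 \<le> K" and k: "CARD('k) \<ge> 3"
    and S: "finite S" "\<And>s i. s \<in> S \<Longrightarrow> L \<le> s i" and T: "finite T"
  shows "measure lborel (shells m y S \<inter> shells n y T) \<le> measure lborel (shells n y T) *
    ((1 + 1 / K) ^ CARD('k) * measure lborel (shells m y S) +
     ((2 * K + 1) ^ CARD('k) + real (CARD('k)\<^sup>2) * 2 ^ CARD('k) * 2 * (2 * K + 1)) *
       ((real (gcd m n) / real n) ^ 3 + real (gcd m n) / real n * (1/2) ^ L))"
    (is "_ \<le> _ * ?R")
proof -
  let ?x = "real (gcd m n) / real n"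
  have x: "0 < ?x" "?x \<le> 1" using n by (auto simp: gcd_le2_nat)
  have one: "(\<Sum>s\<in>S. measure lborel (shell m y s \<inter> shell n y t)) \<le> (\<Prod>i\<in>UNIV. (1/2) ^ Suc (t i)) * ?R" for t
  proof -
    let ?J = "\<lambda>i. hits n (y $ i) ((1/2) ^ Suc (t i)) ((1/2) ^ t i)"
    let ?H = "\<lambda>i a. hits m (y $ i) ((1/2) ^ Suc a) ((1/2) ^ a)"
    define \<phi> where "\<phi> i a = measure lborel (?H i a \<inter> ?J i) / (1/2) ^ Suc (t i)" for i and a :: nat
    \<comment> \<open>Stated for an arbitrary interval: it serves both a single shell and the arc
      [0, 2^-a) that contains a tail of shells.\<close>
    have J: "measure lborel (hits m (y $ i) a b \<inter> ?J i) / (1/2) ^ Suc (t i) \<le> b - a + ?x" if "a \<le> b" for i a b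
    proof -
      have "measure lborel (hits m (y $ i) a b \<inter> ?J i) \<le> ((1/2) ^ t i - (1/2) ^ Suc (t i)) * (b - a + ?x)"
        using half_power_bounds by (intro measure_hits_Int_le[OF n that]) auto
      also have "(1/2::real) ^ t i - (1/2) ^ Suc (t i) = (1/2) ^ Suc (t i)" by simp
      finally show ?thesis by (subst divide_le_eq) (simp_all add: mult.commute)
    qed
    have "measure lborel (shell m y s \<inter> shell n y t) = (\<Prod>i\<in>UNIV. (1/2) ^ Suc (t i)) * (\<Prod>i\<in>UNIV. \<phi> i (s i))" for s
    proof -
      have "shell m y s \<inter> shell n y t = {x. \<forall>i. x $ i \<in> ?H i (s i) \<inter> ?J i}" by (auto simp: shell_def)
      hence "measure lborel (shell m y s \<inter> shell n y t) = (\<Prod>i\<in>UNIV. measure lborel (?H i (s i) \<inter> ?J i))"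
        by (simp only:) (rule measure_lborel_vec_prod, auto)
      also have "\<dots> = (\<Prod>i\<in>UNIV. (1/2) ^ Suc (t i) * \<phi> i (s i))" by (simp add: \<phi>_def)
      finally show ?thesis by (simp only: prod.distrib)
    qed
    hence "(\<Sum>s\<in>S. measure lborel (shell m y s \<inter> shell n y t)) = (\<Prod>i\<in>UNIV. (1/2) ^ Suc (t i)) * (\<Sum>s\<in>S. \<Prod>i\<in>UNIV. \<phi> i (s i))"
      by (simp only: sum_distrib_left)
    also have "(\<Sum>s\<in>S. \<Prod>i\<in>UNIV. \<phi> i (s i)) \<le> ?R"
      unfolding measure_shells[OF m S(1)]
    proof (rule sum_dyadic_tuples_le[where \<phi> = \<phi> and S = S and L = L, OF x K k S(1)])
      show "L \<le> s i" if "s \<in> S" for s i using that by (rule S(2))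
      show "0 \<le> \<phi> i a" for i a by (simp add: \<phi>_def)
      show "\<phi> i a \<le> (1/2) ^ Suc a + ?x" for i a
      proof -
        have "\<phi> i a \<le> (1/2) ^ a - (1/2) ^ Suc a + ?x"
          unfolding \<phi>_def using half_power_bounds(3) by (rule J)
        thus ?thesis by simp
      qed
      fix i a and F :: "nat set" assume F: "finite F" "F \<subseteq> {a..}"
      have sub: "?H i b \<subseteq> hits m (y $ i) 0 ((1/2) ^ a)" if "b \<in> F" for b
      proof -
        have "a \<le> b" using that F by auto
        hence "(1/2::real) ^ b \<le> (1/2) ^ a" by (intro power_decreasing) auto
        from order_less_le_trans[OF _ this] show ?thesis
          unfolding hits_def by auto
      qed
      \<comment> \<open>The shells in F are disjoint inside one arc, so the error of the grid count
        occurs once for the whole tail.\<close>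
      have "(\<Sum>b\<in>F. measure lborel (?H i b \<inter> ?J i)) = measure lborel (\<Union>b\<in>F. ?H i b \<inter> ?J i)"
      proof (rule measure_finite_Union[symmetric, OF F(1)])
        show "disjoint_family_on (\<lambda>b. ?H i b \<inter> ?J i) F"
          using hits_dyadic_disjoint unfolding disjoint_family_on_def by blast
        show "emeasure lborel (?H i b \<inter> ?J i) \<noteq> \<infinity>" for b
          using hits_subset by (intro emeasure_unit_subset_finite) blast
      qed auto
      also have "\<dots> \<le> measure lborel (hits m (y $ i) 0 ((1/2) ^ a) \<inter> ?J i)"
      proof (rule measure_mono_fmeasurable)
        show "(\<Union>b\<in>F. ?H i b \<inter> ?J i) \<subseteq> hits m (y $ i) 0 ((1/2) ^ a) \<inter> ?J i" using sub by blast
        show "(\<Union>b\<in>F. ?H i b \<inter> ?J i) \<in> sets lborel" using F by (intro sets.finite_UN) auto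
        have "emeasure lborel (hits m (y $ i) 0 ((1/2) ^ a) \<inter> ?J i) \<noteq> \<infinity>"
          using hits_subset by (intro emeasure_unit_subset_finite) blast
        thus "hits m (y $ i) 0 ((1/2) ^ a) \<inter> ?J i \<in> fmeasurable lborel"
          by (intro fmeasurableI) (auto simp: less_top)
      qed
      finally have "(\<Sum>b\<in>F. measure lborel (?H i b \<inter> ?J i)) / (1/2) ^ Suc (t i)
          \<le> measure lborel (hits m (y $ i) 0 ((1/2) ^ a) \<inter> ?J i) / (1/2) ^ Suc (t i)"
        by (rule divide_right_mono) simp
      hence "sum (\<phi> i) F \<le> measure lborel (hits m (y $ i) 0 ((1/2) ^ a) \<inter> ?J i) / (1/2) ^ Suc (t i)"
        by (simp only: \<phi>_def[abs_def] sum_divide_distrib)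
      also have "\<dots> \<le> (1/2) ^ a - 0 + ?x" by (rule J) simp
      finally show "sum (\<phi> i) F \<le> (1/2) ^ a + ?x" by simp
    qed
    hence "(\<Prod>i\<in>UNIV. (1/2) ^ Suc (t i)) * (\<Sum>s\<in>S. \<Prod>i\<in>UNIV. \<phi> i (s i)) \<le> (\<Prod>i\<in>UNIV. (1/2) ^ Suc (t i)) * ?R"
      by (rule mult_left_mono) (auto intro!: prod_nonneg)
    finally show ?thesis .
  qed
  have "shells m y S \<inter> shells n y T = (\<Union>t\<in>T. \<Union>s\<in>S. shell m y s \<inter> shell n y t)"
    by (auto simp: shells_def)
  hence "measure lborel (shells m y S \<inter> shells n y T) \<le> (\<Sum>t\<in>T. measure lborel (\<Union>s\<in>S. shell m y s \<inter> shell n y t))"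
    using S T by (simp only:) (intro measure_UNION_le sets.finite_UN; simp)
  also have "\<dots> \<le> (\<Sum>t\<in>T. \<Sum>s\<in>S. measure lborel (shell m y s \<inter> shell n y t))"
    using S by (intro sum_mono measure_UNION_le) auto
  also have "\<dots> \<le> (\<Sum>t\<in>T. (\<Prod>i\<in>UNIV. (1/2) ^ Suc (t i)) * ?R)"
    by (intro sum_mono one)
  also have "\<dots> = (\<Sum>t\<in>T. (\<Prod>i\<in>UNIV. (1/2) ^ Suc (t i))) * ?R"
    by (rule sum_distrib_right[symmetric])
  finally show ?thesis by (simp only: measure_shells[OF n T])
qed

section \<open>The divergence case\<close>

lemma dist_int_le_frac: "dist_int u \<le> frac u"
proof -
  have "infdist u \<int> \<le> dist u (of_int \<lfloor>u\<rfloor>)" by (rule infdist_le) simp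
  also have "\<dots> = frac u" by (simp add: dist_real_def frac_def abs_of_nonneg)
  finally show ?thesis by (simp add: dist_int_def)
qed

lemma dist_int_nonneg: "0 \<le> dist_int u"
  by (simp add: dist_int_def infdist_nonneg)

text \<open>The inequality is strict because shells omit their upper end. Hence a tuple whose
  product is only at most \<psi>(m) still yields solutions of the strict inequality.\<close>

lemma prod_dist_int_less:
  fixes x y :: "real ^ 'k::finite"
  assumes "x \<in> shell m y s"
  shows "(\<Prod>i\<in>UNIV. dist_int (real m * x $ i - y $ i)) < (\<Prod>i\<in>UNIV. (1/2) ^ s i)"
proof -
  have lt: "dist_int (real m * x $ i - y $ i) < (1/2) ^ s i" for i
  proof -
    have "frac (real m * x $ i - y $ i) < (1/2) ^ s i" using assms by (auto simp: shell_def hits_def)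
    thus ?thesis using dist_int_le_frac[of "real m * x $ i - y $ i"] by linarith
  qed
  show ?thesis
    by (rule prod_mono_strict[of undefined]) (auto simp: lt less_imp_le dist_int_nonneg)
qed

text \<open>S consists of all tuples with sum N and entries at least L, where 2^-N <= \<psi> <= 2 *
  2^-N and L = N div (2 k). There are at least L^(k-1) of them, each of volume 2^-(N+k), whence
  2^(k+1). The factor 2 in the bound on 2^-L pays for rounding L down. The volume is measured by L
  rather than log (1/\<psi>), since the bound on 2^-L turns a power decay of \<psi> into a lower
  bound for L by log n.\<close>

lemma dyadic_tuples_exist:
  fixes \<psi> :: real
  assumes \<psi>: "0 < \<psi>" "\<psi> < 1"
  shows "\<exists>L. \<exists>S :: ('k::finite \<Rightarrow> nat) set. finite S \<and> (\<forall>s\<in>S. \<forall>i. L \<le> s i) \<and>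
     (\<forall>s\<in>S. (\<Prod>i\<in>UNIV. (1/2) ^ s i) \<le> \<psi>) \<and>
     (1/2) ^ L \<le> 2 * \<psi> powr (1 / (2 * real CARD('k))) \<and>
     \<psi> * real L ^ (CARD('k) - 1) \<le> 2 ^ (CARD('k) + 1) * (\<Sum>s\<in>S. \<Prod>i\<in>UNIV. (1/2) ^ Suc (s i))"
proof -
  let ?k = "CARD('k)"
  have k0: "?k > 0" by simp
  define N where "N = nat \<lceil>log 2 (1 / \<psi>)\<rceil>"
  have lpos: "log 2 (1 / \<psi>) > 0" using \<psi> by (subst zero_less_log_cancel_iff) auto
  have N: "log 2 (1 / \<psi>) \<le> real N" "real N < log 2 (1 / \<psi>) + 1" using lpos unfolding N_def by linarith+
  have "2 powr log 2 (1 / \<psi>) \<le> 2 powr real N" using N by (intro powr_mono) auto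
  hence N1: "(1/2) ^ N \<le> \<psi>" using \<psi> by (simp add: powr_realpow field_simps power_one_over)
  have "2 powr real N \<le> 2 powr (log 2 (1 / \<psi>) + 1)" using N by (intro powr_mono) auto
  hence N2: "\<psi> \<le> 2 * (1/2) ^ N" using \<psi> by (simp add: powr_add powr_realpow field_simps power_one_over)
  define L where "L = N div (2 * ?k)"
  have "2 * ?k * L \<le> N" unfolding L_def by (rule times_div_less_eq_dividend)
  moreover have "N < 2 * ?k * (L + 1)"
    using k0 dividend_less_times_div[of "2 * ?k" N] by (simp add: L_def algebra_simps)
  ultimately have LN: "2 * ?k * L \<le> N" "N < 2 * ?k * (L + 1)" by simp_all
  define S where "S = {s :: 'k \<Rightarrow> nat. (\<forall>i. L \<le> s i) \<and> (\<Sum>i\<in>UNIV. s i) = N}"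
  have "S \<subseteq> PiE UNIV (\<lambda>_. {..N})"
  proof
    fix s assume "s \<in> S"
    hence "s i \<le> N" for i using member_le_sum[of i UNIV s] by (auto simp: S_def)
    thus "s \<in> PiE UNIV (\<lambda>_. {..N})" by auto
  qed
  hence fin: "finite S" by (rule finite_subset) (auto intro!: finite_PiE)
  define i0 :: 'k where "i0 = undefined"
  (* All coordinates but i0 are free in [L, 2L); the last one, fixed by the sum, is then at least 2L. *)
  define f where "f g = (\<lambda>i. if i = i0 then N - (\<Sum>j\<in>UNIV - {i0}. g j) else g i)" for g :: "'k \<Rightarrow> nat"
  let ?G = "PiE (UNIV - {i0}) (\<lambda>_. {L..<2 * L})"
  have cardU: "card (UNIV - {i0}) = ?k - 1" by simp
  have "card ?G \<le> card S"
  proof (rule card_inj_on_le[OF _ _ fin])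
    show "inj_on f ?G"
    proof (rule inj_onI)
      fix g h assume gh: "g \<in> ?G" "h \<in> ?G" and eq: "f g = f h"
      show "g = h"
      proof (rule PiE_ext[OF gh])
        fix i assume "i \<in> UNIV - {i0}"
        thus "g i = h i" using fun_cong[OF eq, of i] by (simp add: f_def)
      qed
    qed
    show "f ` ?G \<subseteq> S"
    proof (rule image_subsetI)
      fix g assume g: "g \<in> ?G"
      have "(\<Sum>j\<in>UNIV - {i0}. g j) \<le> (\<Sum>j\<in>UNIV - {i0}. 2 * L)"
        using g by (intro sum_mono) (auto simp: PiE_iff dest!: bspec)
      also have "\<dots> = (?k - 1) * (2 * L)" by (simp only: sum_constant cardU) simp
      finally have le: "(\<Sum>j\<in>UNIV - {i0}. g j) + 2 * L \<le> 2 * ?k * L"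
        using k0 by (cases ?k) (auto simp: algebra_simps)
      have "(\<Sum>i\<in>UNIV. f g i) = f g i0 + (\<Sum>j\<in>UNIV - {i0}. f g j)" by (simp add: sum.remove)
      also have "(\<Sum>j\<in>UNIV - {i0}. f g j) = (\<Sum>j\<in>UNIV - {i0}. g j)" by (rule sum.cong) (auto simp: f_def)
      also have "f g i0 + \<dots> = N" using le LN(1) by (simp add: f_def)
      finally have "(\<Sum>i\<in>UNIV. f g i) = N" .
      moreover have "L \<le> f g i" for i
      proof (cases "i = i0")
        case True
        thus ?thesis using le LN(1) by (simp add: f_def)
      next
        case False
        thus ?thesis using g by (auto simp: f_def PiE_iff)
      qed
      ultimately show "f g \<in> S" by (simp add: S_def)
    qed
  qed
  also have "card ?G = L ^ (?k - 1)" by (simp add: card_PiE)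
  finally have cardS: "real L ^ (?k - 1) \<le> real (card S)" by (metis of_nat_le_iff of_nat_power)
  have "(\<Sum>s\<in>S. \<Prod>i\<in>UNIV. (1/2::real) ^ Suc (s i)) = (\<Sum>s\<in>S. (1/2) ^ (N + ?k))"
  proof (rule sum.cong[OF refl])
    fix s assume s: "s \<in> S"
    have "(\<Prod>i\<in>UNIV. (1/2::real) ^ Suc (s i)) = (1/2) ^ (\<Sum>i\<in>UNIV. Suc (s i))" by (rule power_sum[symmetric])
    also have "(\<Sum>i\<in>UNIV. Suc (s i)) = N + ?k" using s by (simp add: S_def sum_Suc)
    finally show "(\<Prod>i\<in>UNIV. (1/2::real) ^ Suc (s i)) = (1/2) ^ (N + ?k)" .
  qed
  hence sumS: "2 ^ (?k + 1) * (\<Sum>s\<in>S. \<Prod>i\<in>UNIV. (1/2::real) ^ Suc (s i)) = real (card S) * (2 * (1/2) ^ N)"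
    by (simp add: power_add power_one_over)
  have "\<psi> * real L ^ (?k - 1) \<le> (2 * (1/2) ^ N) * real (card S)"
    using cardS N2 \<psi> by (intro mult_mono) auto
  hence m: "\<psi> * real L ^ (?k - 1) \<le> 2 ^ (?k + 1) * (\<Sum>s\<in>S. \<Prod>i\<in>UNIV. (1/2) ^ Suc (s i))"
    unfolding sumS by (subst mult.commute[of "real (card S)"])
  have "(1/2) ^ L \<le> 2 * \<psi> powr (1 / (2 * real ?k))"
  proof -
    have "real N < 2 * real ?k * (real L + 1)"
      using LN(2)[folded of_nat_less_iff[where 'a = real]]
      by (simp only: of_nat_mult of_nat_add of_nat_numeral of_nat_1)
    hence "real N / (2 * real ?k) \<le> real L + 1" using k0 by (simp add: field_simps)
    hence "(1/2) powr (real L + 1) \<le> (1/2) powr (real N / (2 * real ?k))" by (intro powr_mono') auto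
    also have "\<dots> = ((1/2) ^ N) powr (1 / (2 * real ?k))" by (simp add: powr_powr flip: powr_realpow)
    also have "\<dots> \<le> \<psi> powr (1 / (2 * real ?k))" using N1 by (intro powr_mono2) auto
    finally show ?thesis by (simp add: powr_add powr_realpow)
  qed
  moreover have "(\<Prod>i\<in>UNIV. (1/2) ^ s i) \<le> \<psi>" if "s \<in> S" for s
    using N1 that by (simp add: S_def flip: power_sum)
  ultimately show ?thesis using fin m by (intro exI[of _ L] exI[of _ S]) (auto simp: S_def)
qed

text \<open>For n < n0 the trivial bound \<psi> n < 1 <= n0^\<epsilon> n^-\<epsilon> is enough, so
  n0^\<epsilon> is added to the constant.\<close>

lemma powr_decay_everywhere:
  fixes \<psi> :: "nat \<Rightarrow> real"
  assumes \<psi>: "\<And>n. n \<ge> 1 \<Longrightarrow> 0 \<le> \<psi> n \<and> \<psi> n < 1" and O: "\<psi> \<in> O(\<lambda>n. real n powr - \<epsilon>)" and \<epsilon>: "\<epsilon> > 0"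
  shows "\<exists>c>0. \<forall>n\<ge>1. \<psi> n \<le> c * real n powr - \<epsilon>"
proof -
  obtain c where c: "c > 0" "eventually (\<lambda>n. norm (\<psi> n) \<le> c * norm (real n powr - \<epsilon>)) at_top"
    using O by (elim landau_o.bigE) auto
  then obtain n0 where n0: "\<And>n. n \<ge> n0 \<Longrightarrow> norm (\<psi> n) \<le> c * norm (real n powr - \<epsilon>)"
    by (auto simp: eventually_at_top_linorder)
  let ?c = "c + real n0 powr \<epsilon>"
  have "\<psi> n \<le> ?c * real n powr - \<epsilon>" if n: "n \<ge> 1" for n
  proof (cases "n \<ge> n0")
    case True
    have "\<psi> n \<le> c * real n powr - \<epsilon>" using n0[OF True] by simp
    also have "\<dots> \<le> ?c * real n powr - \<epsilon>" by (intro mult_right_mono) auto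
    finally show ?thesis .
  next
    case False
    have "\<psi> n \<le> 1" using \<psi>[OF n] by simp
    also have "1 = real n powr \<epsilon> * real n powr - \<epsilon>" using n by (simp add: powr_minus)
    also have "\<dots> \<le> real n0 powr \<epsilon> * real n powr - \<epsilon>"
      using False n \<epsilon> by (intro mult_right_mono powr_mono2) auto
    also have "\<dots> \<le> ?c * real n powr - \<epsilon>" using c by (intro mult_right_mono) auto
    finally show ?thesis .
  qed
  moreover have "?c > 0" using c by (simp add: add_pos_nonneg)
  ultimately show ?thesis by blast
qed

lemma one_plus_inverse_power_le:
  assumes "(0::real) < \<delta>"
  shows "\<exists>K\<ge>1. (1 + 1 / K) ^ k \<le> 1 + \<delta>"
proof -
  have "((\<lambda>K::real. (1 + 1 / K) ^ k) \<longlongrightarrow> (1 + 0) ^ k) at_top"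
    by (intro tendsto_intros tendsto_divide_0[OF tendsto_const] filterlim_at_top_imp_at_infinity filterlim_ident)
  hence "eventually (\<lambda>K::real. (1 + 1 / K) ^ k < 1 + \<delta>) at_top"
    using assms by (intro order_tendstoD) auto
  hence "eventually (\<lambda>K::real. (1 + 1 / K) ^ k < 1 + \<delta> \<and> K \<ge> 1) at_top"
    using eventually_ge_at_top by (rule eventually_conj)
  thus ?thesis by (metis (mono_tags, lifting) eventually_happens' less_imp_le trivial_limit_at_top_linorder)
qed

section \<open>Measurability of the set of infinitely often approximable points\<close>

lemma borel_dist_int [measurable]: "dist_int \<in> borel_measurable borel"
  unfolding dist_int_def by (intro borel_measurable_continuous_onI continuous_intros)

lemma borel_prod_dist_int_less:
  fixes y :: "real ^ 'k::finite"
  shows "{x. (\<Prod>i\<in>UNIV. dist_int (real n * x $ i - y $ i)) < c} \<in> sets borel"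
proof -
  have di: "continuous_on UNIV dist_int" unfolding dist_int_def by (intro continuous_intros)
  have "(\<lambda>x::real^'k. \<Prod>i\<in>UNIV. dist_int (real n * x $ i - y $ i)) \<in> borel_measurable borel"
    by (intro borel_measurable_continuous_onI continuous_intros continuous_on_compose2[OF di]) auto
  thus ?thesis unfolding borel_measurable_iff_less by simp
qed

lemma borel_W_mult:
  fixes y :: "real ^ 'k::finite"
  shows "W_mult \<psi> y \<in> sets borel"
proof -
  define B where "B n = {x::real^'k. n \<ge> 1 \<and> (\<Prod>i\<in>UNIV. dist_int (real n * x $ i - y $ i)) < \<psi> n}" for n
  have B: "B n \<in> sets borel" for n
  proof (cases "n \<ge> 1")
    case True
    thus ?thesis using borel_prod_dist_int_less by (simp add: B_def)
  next
    case False
    hence "B n = {}" unfolding B_def by blast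
    thus ?thesis by simp
  qed
  have "(\<Union>n\<in>{m..}. B n) \<in> sets borel" for m
    using B by (intro sets.countable_UN') auto
  hence "(\<Inter>m. \<Union>n\<in>{m..}. B n) \<in> sets borel" by (intro sets.countable_INT) auto
  hence "(\<Inter>m. \<Union>n\<in>{m..}. B n) \<inter> unit_cube \<in> sets borel" by (rule sets.Int[OF _ borel_unit_cube])
  also have "(\<Inter>m. \<Union>n\<in>{m..}. B n) \<inter> unit_cube = W_mult \<psi> y"
  proof (unfold set_eq_iff, rule allI)
    fix x
    have "infinite {n. x \<in> B n} \<longleftrightarrow> (\<forall>m. \<exists>n\<ge>m. x \<in> B n)" by (simp add: infinite_nat_iff_unbounded_le)
    hence "infinite {n. x \<in> B n} \<longleftrightarrow> x \<in> (\<Inter>m. \<Union>n\<in>{m..}. B n)" by auto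
    moreover have "x \<in> W_mult \<psi> y \<longleftrightarrow> x \<in> unit_cube \<and> infinite {n. x \<in> B n}"
      by (simp add: W_mult_def unit_cube_def B_def)
    ultimately show "x \<in> (\<Inter>m. \<Union>n\<in>{m..}. B n) \<inter> unit_cube \<longleftrightarrow> x \<in> W_mult \<psi> y" by blast
  qed
  finally show ?thesis .
qed

lemma W_mult_full:
  fixes y :: "real ^ 'k::finite" and \<psi> :: "nat \<Rightarrow> real"
  assumes \<psi>: "\<And>n. n \<ge> 1 \<Longrightarrow> 0 \<le> \<psi> n \<and> \<psi> n < 1" and k: "CARD('k) \<ge> 3"
    and \<epsilon>: "0 < \<epsilon>" "\<epsilon> \<le> 1" and O: "\<psi> \<in> O(\<lambda>n. real n powr - \<epsilon>)"
    and div: "\<not> summable (\<lambda>n. \<psi> (n + 1) * ln (real (n + 1)) ^ (CARD('k) - 1))"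
  shows "emeasure lborel (W_mult \<psi> y) = 1"
proof -
  let ?k = "CARD('k)"
  obtain c where c: "c > 0" "\<And>n. n \<ge> 1 \<Longrightarrow> \<psi> n \<le> c * real n powr - \<epsilon>"
    using powr_decay_everywhere[OF \<psi> O \<epsilon>(1)] by blast
  \<comment> \<open>Raising \<psi> m <= c m^-\<epsilon> to the power 1/(2k) gives 2^-L <= q
    m^-\<eta>, with \<open>q\<close> collecting the constants. From \<epsilon> <= 1 and k >= 3
    follows \<eta> <= 1/2, the range of the gcd sums.\<close>
  define \<eta> where "\<eta> = \<epsilon> / (2 * real ?k)"
  have \<eta>: "0 < \<eta>" "\<eta> \<le> 1/2" using \<epsilon> k by (auto simp: \<eta>_def field_simps)
  define q where "q = 2 * c powr (1 / (2 * real ?k))"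
  have q0: "q > 0" using c by (simp add: q_def)
  define P where "P m L S \<longleftrightarrow> finite S \<and> (\<forall>s\<in>S. \<forall>i. L \<le> s i) \<and>
     (\<forall>s\<in>S. (\<Prod>i\<in>UNIV. (1/2) ^ s i) \<le> \<psi> m) \<and>
     (1/2) ^ L \<le> 2 * \<psi> m powr (1 / (2 * real ?k)) \<and>
     \<psi> m * real L ^ (?k - 1) \<le> 2 ^ (?k + 1) * (\<Sum>s\<in>S. \<Prod>i\<in>UNIV. (1/2) ^ Suc (s i))"
    for m L and S :: "('k \<Rightarrow> nat) set"
  have "\<exists>L S. P m L S" if "m \<ge> 1" "\<psi> m > 0" for m
    unfolding P_def using dyadic_tuples_exist[OF that(2)] \<psi>[OF that(1)] by blast
  hence "\<forall>m. \<exists>L S. m \<ge> 1 \<and> \<psi> m > 0 \<longrightarrow> P m L S" by blast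
  then obtain L S0 where "\<And>m. m \<ge> 1 \<and> \<psi> m > 0 \<longrightarrow> P m (L m) (S0 m)" by metis
  hence LS: "finite (S0 m) \<and> (\<forall>s\<in>S0 m. \<forall>i. L m \<le> s i) \<and>
     (\<forall>s\<in>S0 m. (\<Prod>i\<in>UNIV. (1/2) ^ s i) \<le> \<psi> m) \<and>
     (1/2) ^ L m \<le> 2 * \<psi> m powr (1 / (2 * real ?k)) \<and>
     \<psi> m * real (L m) ^ (?k - 1) \<le> 2 ^ (?k + 1) * (\<Sum>s\<in>S0 m. \<Prod>i\<in>UNIV. (1/2) ^ Suc (s i))"
    if "m \<ge> 1" "\<psi> m > 0" for m using that unfolding P_def by blast
  \<comment> \<open>Tuples are available for m >= 1 with \<psi> m > 0; for all other m the
    approximating set is taken empty.\<close>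
  define S where "S m = (if m \<ge> 1 \<and> \<psi> m > 0 then S0 m else {})" for m
  have finS: "finite (S m)" for m using LS[of m] by (simp add: S_def)
  have SL: "L m \<le> s i" if "s \<in> S m" for m s i using LS[of m] that by (auto simp: S_def split: if_splits)
  have S\<psi>: "(\<Prod>i\<in>UNIV. (1/2) ^ s i) \<le> \<psi> m" "m \<ge> 1" if "s \<in> S m" for m s
    using LS[of m] that by (auto simp: S_def split: if_splits)
  have Lq: "(1/2) ^ L m \<le> q * real m powr - \<eta>" if "m \<ge> 1" "\<psi> m > 0" for m
  proof -
    have "(1/2) ^ L m \<le> 2 * \<psi> m powr (1 / (2 * real ?k))" using LS[OF that] by blast
    also have "\<dots> \<le> 2 * (c * real m powr - \<epsilon>) powr (1 / (2 * real ?k))"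
      using c(2)[OF that(1)] that by (intro mult_left_mono powr_mono2) auto
    also have "\<dots> = q * real m powr - \<eta>"
      using c by (simp add: q_def \<eta>_def powr_mult powr_powr)
    finally show ?thesis .
  qed
  define A where "A m = shells m y (S m)" for m
  \<comment> \<open>Lebesgue measure on the unit cube as a probability measure, the setting of the
    second-moment criterion.\<close>
  define \<mu> where "\<mu> = restrict_space (lborel :: (real ^ 'k) measure) unit_cube"
  have Aborel: "A m \<in> sets borel" for m unfolding A_def by (rule borel_shells[OF finS])
  have Asub: "A m \<subseteq> unit_cube" for m unfolding A_def by (rule shells_subset)
  have sp: "space \<mu> = unit_cube" by (simp add: \<mu>_def space_restrict_space)
  have em: "emeasure \<mu> B = emeasure lborel B" if "B \<subseteq> unit_cube" for B
    unfolding \<mu>_def using that by (intro emeasure_restrict_space) auto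
  have me: "measure \<mu> B = measure lborel B" if "B \<subseteq> unit_cube" for B
    using em[OF that] by (simp add: measure_def)
  have \<mu>: "finite_measure \<mu>" by (intro finite_measureI) (simp add: sp em measure_unit_cube)
  have \<mu>1: "measure \<mu> (space \<mu>) = 1" by (simp add: sp em measure_unit_cube measure_def)
  have A: "A m \<in> sets \<mu>" for m
    unfolding \<mu>_def using Aborel[of m] Asub[of m] by (auto simp: sets_restrict_space_iff)
  have A0: "A m = {}" if "\<not> (m \<ge> 1 \<and> \<psi> m > 0)" for m
    using that by (simp only: A_def S_def shells_def if_False UN_empty)
  obtain G where G: "G > 0" "\<And>n. n > 0 \<Longrightarrow> (\<Sum>m\<in>{1..<n}. (real (gcd m n) / real n) ^ 3) \<le> G \<and>
     (\<Sum>m\<in>{1..<n}. real (gcd m n) / real n * real m powr - \<eta>) \<le> G"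
    using sum_gcd_bound[OF \<eta>] by blast
  have indep: "\<exists>C e. (\<forall>m n. (0::real) \<le> e m n) \<and> (\<forall>n. (\<Sum>m<n. e m n) \<le> C) \<and>
       (\<forall>m n. m < n \<longrightarrow> measure \<mu> (A m \<inter> A n) \<le> measure \<mu> (A n) * ((1 + \<delta>) * measure \<mu> (A m) + e m n))"
    if \<delta>: "\<delta> > 0" for \<delta> :: real
  proof -
    obtain K where K: "K \<ge> 1" "(1 + 1 / K) ^ ?k \<le> 1 + \<delta>" using one_plus_inverse_power_le[OF \<delta>] by blast
    define D where "D = (2 * K + 1) ^ ?k + real (?k\<^sup>2) * 2 ^ ?k * 2 * (2 * K + 1)"
    have D0: "D \<ge> 0" using K by (simp add: D_def)
    \<comment> \<open>The side bound 2^-L is replaced by q m^-\<eta>, which makes sense also where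
      no tuples were chosen. The value at m = 0 can be 0 because \<open>A 0\<close> is
      empty.\<close>
    define e where "e m n = (if m = 0 then 0 else D * ((real (gcd m n) / real n) ^ 3 + real (gcd m n) / real n * (q * real m powr - \<eta>)))" for m n
    have e0: "0 \<le> e m n" for m n using D0 q0 by (simp add: e_def)
    have "(\<Sum>m<n. e m n) \<le> D * (G + q * G)" for n
    proof (cases "n = 0")
      case True
      thus ?thesis using D0 q0 G by simp
    next
      case False
      have "(\<Sum>m<n. e m n) = (\<Sum>m\<in>{1..<n}. e m n)"
        by (rule sum.mono_neutral_right) (auto simp: e_def)
      also have "\<dots> = (\<Sum>m\<in>{1..<n}. D * ((real (gcd m n) / real n) ^ 3 + q * (real (gcd m n) / real n * real m powr - \<eta>)))"
        by (intro sum.cong) (auto simp: e_def)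
      also have "\<dots> = D * ((\<Sum>m\<in>{1..<n}. (real (gcd m n) / real n) ^ 3) + q * (\<Sum>m\<in>{1..<n}. real (gcd m n) / real n * real m powr - \<eta>))"
        by (simp only: sum.distrib flip: sum_distrib_left)
      also have "\<dots> \<le> D * (G + q * G)"
        using G(2)[of n] False D0 q0 by (intro mult_left_mono add_mono) auto
      finally show ?thesis .
    qed
    moreover have "measure \<mu> (A m \<inter> A n) \<le> measure \<mu> (A n) * ((1 + \<delta>) * measure \<mu> (A m) + e m n)" if mn: "m < n" for m n
    proof (cases "m \<ge> 1 \<and> \<psi> m > 0")
      case False
      thus ?thesis using A0[OF False] e0[of m n] by simp
    next
      case True
      let ?x = "real (gcd m n) / real n"
      have "measure lborel (A m \<inter> A n) \<le> measure lborel (A n) * ((1 + 1 / K) ^ ?k * measure lborel (A m) + D * (?x ^ 3 + ?x * (1/2) ^ L m))"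
        unfolding A_def D_def using True mn by (intro measure_shells_Int_le K k finS SL) auto
      also have "\<dots> \<le> measure lborel (A n) * ((1 + \<delta>) * measure lborel (A m) + D * (?x ^ 3 + ?x * (q * real m powr - \<eta>)))"
        using True D0 by (intro mult_left_mono add_mono mult_right_mono K Lq order_refl) auto
      also have "D * (?x ^ 3 + ?x * (q * real m powr - \<eta>)) = e m n" using True by (simp add: e_def)
      finally show ?thesis using Asub by (simp add: me le_infI1)
    qed
    ultimately show ?thesis using e0 by blast
  qed
  have div': "\<not> summable (\<lambda>m. measure \<mu> (A m))"
  proof
    assume sum: "summable (\<lambda>m. measure \<mu> (A m))"
    \<comment> \<open>From 2^-L <= q m^-\<eta> follows L ln 2 >= \<eta> ln m - ln q, and ln q is at
      most half of \<eta> ln m once ln m >= 2 ln q / \<eta>. Hence L >= \<open>?b\<close> * ln m for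
      large m, and the measure of \<open>A m\<close> dominates \<psi> m (ln m)^(k-1) up to a
      constant.\<close>
    let ?b = "\<eta> / (2 * ln 2)"
    have b0: "?b > 0" using \<eta> by simp
    have ev: "eventually (\<lambda>m. norm (\<psi> m * ln (real m) ^ (?k - 1)) \<le> 2 ^ (?k + 1) / ?b ^ (?k - 1) * measure \<mu> (A m)) at_top"
    proof -
      have "filterlim (\<lambda>m. ln (real m)) at_top at_top"
        by (rule filterlim_compose[OF ln_at_top filterlim_real_sequentially])
      hence "eventually (\<lambda>m. ln (real m) \<ge> 2 * ln q / \<eta>) at_top" by (simp add: filterlim_at_top)
      moreover have "eventually (\<lambda>m::nat. m \<ge> 1) at_top" by (rule eventually_ge_at_top)
      ultimately show ?thesis
      proof eventually_elim
        case (elim m)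
        have ln0: "ln (real m) \<ge> 0" using elim by simp
        show ?case
        proof (cases "\<psi> m > 0")
          case False
          hence "\<psi> m = 0" using \<psi>[of m] elim by simp
          thus ?thesis using b0 by simp
        next
          case True
          have "ln ((1/2) ^ L m) \<le> ln (q * real m powr - \<eta>)"
            using Lq[OF _ True] elim q0 by (subst ln_le_cancel_iff) auto
          hence "\<eta> * ln (real m) - ln q \<le> real (L m) * ln 2"
            using elim q0 by (simp add: ln_realpow ln_mult ln_powr ln_div)
          moreover have "ln q \<le> \<eta> / 2 * ln (real m)" using elim(1) \<eta> by (simp add: field_simps)
          ultimately have "?b * ln (real m) \<le> real (L m)" by (simp add: field_simps)
          hence "(?b * ln (real m)) ^ (?k - 1) \<le> real (L m) ^ (?k - 1)"
            using mult_nonneg_nonneg[OF less_imp_le[OF b0] ln0] by (rule power_mono)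
          hence "\<psi> m * (?b * ln (real m)) ^ (?k - 1) \<le> \<psi> m * real (L m) ^ (?k - 1)" using True by (intro mult_left_mono) auto
          also have "\<dots> \<le> 2 ^ (?k + 1) * (\<Sum>s\<in>S0 m. \<Prod>i\<in>UNIV. (1/2) ^ Suc (s i))" using LS[OF _ True] elim by blast
          also have "(\<Sum>s\<in>S0 m. \<Prod>i\<in>UNIV. (1/2) ^ Suc (s i)) = measure \<mu> (A m)"
            using finS[of m] elim True by (subst me[OF Asub]) (simp only: A_def, subst measure_shells, auto simp: S_def)
          finally have "\<psi> m * ln (real m) ^ (?k - 1) * ?b ^ (?k - 1) \<le> 2 ^ (?k + 1) * measure \<mu> (A m)"
            by (simp only: power_mult_distrib mult_ac)
          moreover have "?b ^ (?k - 1) > 0" using b0 by (rule zero_less_power)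
          ultimately have "\<psi> m * ln (real m) ^ (?k - 1) \<le> 2 ^ (?k + 1) / ?b ^ (?k - 1) * measure \<mu> (A m)"
            by (simp only: pos_le_divide_eq times_divide_eq_left)
          thus ?thesis using True ln0 by simp
        qed
      qed
    qed
    have "summable (\<lambda>m. \<psi> m * ln (real m) ^ (?k - 1))"
      by (rule summable_comparison_test_ev[OF ev]) (intro summable_mult sum)
    hence "summable (\<lambda>m. \<psi> (m + 1) * ln (real (m + 1)) ^ (?k - 1))"
      using summable_iff_shift[of "\<lambda>m. \<psi> m * ln (real m) ^ (?k - 1)" 1] by simp
    thus False using div by simp
  qed
  have null: "unit_cube - (\<Union>n\<in>{n0..}. A n) \<in> null_sets lborel" for n0
  proof -
    have "measure \<mu> (space \<mu> - (\<Union>n\<in>{n0..}. A n)) = 0"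
      by (rule null_complement_of_quasi_independent[OF \<mu> \<mu>1 A div' indep])
    hence "measure lborel (unit_cube - (\<Union>n\<in>{n0..}. A n)) = 0" by (simp add: sp me)
    hence "emeasure lborel (unit_cube - (\<Union>n\<in>{n0..}. A n)) = 0"
      using emeasure_cube_subset_finite[of "unit_cube - (\<Union>n\<in>{n0..}. A n)"]
      by (simp add: measure_def enn2real_eq_0_iff)
    moreover have "unit_cube - (\<Union>n\<in>{n0..}. A n) \<in> sets lborel"
      using Aborel by (intro sets.Diff sets.countable_UN') auto
    ultimately show ?thesis by (rule null_setsI)
  qed
  have Wsub: "W_mult \<psi> y \<subseteq> unit_cube" by (auto simp: W_mult_def unit_cube_def)
  \<comment> \<open>A point of the cube outside \<open>W_mult\<close> lies in only finitely many
    \<open>A n\<close>, hence in none from some \<open>n0\<close> on.\<close>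
  have sub: "unit_cube - W_mult \<psi> y \<subseteq> (\<Union>n0. unit_cube - (\<Union>n\<in>{n0..}. A n))"
  proof
    fix x assume x: "x \<in> unit_cube - W_mult \<psi> y"
    show "x \<in> (\<Union>n0. unit_cube - (\<Union>n\<in>{n0..}. A n))"
    proof (rule ccontr)
      assume "x \<notin> (\<Union>n0. unit_cube - (\<Union>n\<in>{n0..}. A n))"
      hence "\<forall>n0. \<exists>n\<ge>n0. x \<in> A n" using x by auto
      hence inf: "infinite {n. x \<in> A n}" by (simp add: infinite_nat_iff_unbounded_le)
      have "{n. x \<in> A n} \<subseteq> {n. n \<ge> 1 \<and> (\<Prod>i\<in>UNIV. dist_int (real n * x $ i - y $ i)) < \<psi> n}"
      proof
        fix n assume "n \<in> {n. x \<in> A n}"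
        then obtain s where s: "s \<in> S n" "x \<in> shell n y s" by (auto simp: A_def shells_def)
        from prod_dist_int_less[OF s(2)] S\<psi>[OF s(1)]
        show "n \<in> {n. n \<ge> 1 \<and> (\<Prod>i\<in>UNIV. dist_int (real n * x $ i - y $ i)) < \<psi> n}" by simp
      qed
      hence "infinite {n. n \<ge> 1 \<and> (\<Prod>i\<in>UNIV. dist_int (real n * x $ i - y $ i)) < \<psi> n}"
        using inf by (rule infinite_super)
      hence "x \<in> W_mult \<psi> y" using x by (auto simp: W_mult_def unit_cube_def)
      with x show False by simp
    qed
  qed
  have "(\<Union>n0. unit_cube - (\<Union>n\<in>{n0..}. A n)) \<in> null_sets lborel"
    by (intro null_sets_UN null)
  hence "unit_cube - W_mult \<psi> y \<in> null_sets lborel"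
    by (rule null_sets_subset[OF _ _ sub]) (simp add: sets.Diff[OF borel_unit_cube borel_W_mult])
  hence "emeasure lborel (unit_cube - (unit_cube - W_mult \<psi> y)) = emeasure lborel (unit_cube :: (real ^ 'k) set)"
    by (rule emeasure_Diff_null_set) simp
  moreover have "unit_cube - (unit_cube - W_mult \<psi> y) = W_mult \<psi> y" using Wsub by blast
  ultimately have "emeasure lborel (W_mult \<psi> y) = emeasure lborel (unit_cube :: (real ^ 'k) set)" by simp
  thus ?thesis by (simp add: measure_unit_cube)
qed

section \<open>The convergence case\<close>

text \<open>An integer on either side of u is at least as far away as the floor of u or its
  successor. So \<open>dist_int u\<close> < \<delta> forces frac u to be within \<delta> of 0 or of
  1.\<close>

lemma dist_int_ge: "min (frac u) (1 - frac u) \<le> dist_int u"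
proof -
  have "min (frac u) (1 - frac u) \<le> dist u z" if z: "z \<in> \<int>" for z
  proof -
    obtain j where j: "z = of_int j" using z by (auto elim: Ints_cases)
    consider "j \<le> \<lfloor>u\<rfloor>" | "j \<ge> \<lfloor>u\<rfloor> + 1" by linarith
    thus ?thesis
    proof cases
      case 1
      hence "real_of_int j \<le> of_int \<lfloor>u\<rfloor>" by simp
      thus ?thesis unfolding j dist_real_def frac_def by linarith
    next
      case 2
      hence "real_of_int j \<ge> of_int \<lfloor>u\<rfloor> + 1" by linarith
      thus ?thesis unfolding j dist_real_def frac_def by linarith
    qed
  qed
  hence "min (frac u) (1 - frac u) \<le> (INF z\<in>\<int>. dist u z)" by (intro cINF_greatest) auto
  moreover have "(\<int> :: real set) \<noteq> {}" using Ints_0 by blast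
  ultimately show ?thesis by (simp add: dist_int_def infdist_def)
qed

text \<open>Two-sided, unlike \<open>hits\<close>: a cover must also catch the points where n x - y
  is just below an integer.\<close>

definition near :: "nat \<Rightarrow> real \<Rightarrow> real \<Rightarrow> real set" where
  "near n y \<delta> = {x\<in>{0..<1}. dist_int (real n * x - y) < \<delta>}"

lemma borel_near [measurable]: "near n y \<delta> \<in> sets borel"
proof -
  have "(\<lambda>x. dist_int (real n * x - y)) \<in> borel_measurable borel" by measurable
  hence "{x. dist_int (real n * x - y) < \<delta>} \<in> sets borel"
    unfolding borel_measurable_iff_less by simp
  hence "{0..<1} \<inter> {x. dist_int (real n * x - y) < \<delta>} \<in> sets borel" by (intro sets.Int) auto
  also have "{0..<1} \<inter> {x. dist_int (real n * x - y) < \<delta>} = near n y \<delta>" by (auto simp: near_def)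
  finally show ?thesis .
qed

lemma measure_near_le:
  assumes n: "n > 0" and \<delta>: "0 \<le> \<delta>" "\<delta> \<le> 1"
  shows "measure lborel (near n y \<delta>) \<le> 2 * \<delta>"
proof -
  have "measure lborel (near n y \<delta>) \<le> measure lborel (hits n y 0 \<delta> \<union> hits n y (1 - \<delta>) 1)"
  proof (rule measure_mono_fmeasurable)
    show "near n y \<delta> \<subseteq> hits n y 0 \<delta> \<union> hits n y (1 - \<delta>) 1"
    proof
      fix x assume x: "x \<in> near n y \<delta>"
      let ?u = "real n * x - y"
      have "frac ?u < \<delta> \<or> 1 - \<delta> \<le> frac ?u" using x dist_int_ge[of ?u] by (auto simp: near_def)
      thus "x \<in> hits n y 0 \<delta> \<union> hits n y (1 - \<delta>) 1"
        using x by (auto simp: near_def hits_def frac_lt_1)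
    qed
    have "emeasure lborel (hits n y 0 \<delta> \<union> hits n y (1 - \<delta>) 1) \<noteq> \<infinity>"
      using hits_subset by (intro emeasure_unit_subset_finite) blast
    thus "hits n y 0 \<delta> \<union> hits n y (1 - \<delta>) 1 \<in> fmeasurable lborel"
      by (intro fmeasurableI) (auto simp: less_top)
  qed simp
  also have "\<dots> \<le> measure lborel (hits n y 0 \<delta>) + measure lborel (hits n y (1 - \<delta>) 1)"
    by (rule measure_Un_le) auto
  also have "\<dots> = 2 * \<delta>" using \<delta> by (simp add: measure_hits[OF n])
  finally show ?thesis .
qed

text \<open>Greedy choice: if the other entries suffice, the entry at x becomes 0; otherwise they
  are kept in full and x supplies the rest.\<close>

lemma ex_sum_eq_below:
  fixes s :: "'a \<Rightarrow> nat"
  assumes "finite A" "T \<le> sum s A"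
  shows "\<exists>r. (\<forall>i. r i \<le> s i) \<and> sum r A = T"
  using assms
proof (induction A arbitrary: T rule: finite_induct)
  case empty
  thus ?case by (intro exI[of _ s]) auto
next
  case (insert x A)
  have upd: "sum (s(x := c)) A = sum s A" for s and c :: nat
    using insert.hyps by (intro sum.cong) auto
  show ?case
  proof (cases "T \<le> sum s A")
    case True
    then obtain r where "\<forall>i. r i \<le> s i" "sum r A = T" using insert.IH by blast
    thus ?thesis using insert.hyps
      by (intro exI[of _ "r(x := 0)"]) (simp add: upd del: fun_upd_apply, simp)
  next
    case False
    thus ?thesis using insert.hyps insert.prems
      by (intro exI[of _ "s(x := T - sum s A)"]) (simp add: upd del: fun_upd_apply, auto)
  qed
qed

text \<open>One coordinate is determined by the sum and the others, which lie in {0..T}.\<close>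

lemma card_sum_eq_le:
  "finite {s :: 'k::finite \<Rightarrow> nat. (\<Sum>i\<in>UNIV. s i) = T}"
  "card {s :: 'k::finite \<Rightarrow> nat. (\<Sum>i\<in>UNIV. s i) = T} \<le> (T + 1) ^ (CARD('k) - 1)"
proof -
  let ?Z = "{s :: 'k \<Rightarrow> nat. (\<Sum>i\<in>UNIV. s i) = T}"
  have le: "s i \<le> T" if "s \<in> ?Z" for s i using member_le_sum[of i UNIV s] that by auto
  hence "?Z \<subseteq> PiE UNIV (\<lambda>_. {..T})" by auto
  thus "finite ?Z" by (rule finite_subset) (auto intro!: finite_PiE)
  define i0 :: 'k where "i0 = undefined"
  let ?G = "PiE (UNIV - {i0}) (\<lambda>_. {..T})"
  have "card ?Z \<le> card ?G"
  proof (rule card_inj_on_le)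
    show "(\<lambda>s. restrict s (UNIV - {i0})) ` ?Z \<subseteq> ?G"
      by (rule image_subsetI) (use le in \<open>simp only: restrict_PiE_iff atMost_iff\<close>, blast)
    show "finite ?G" by (auto intro!: finite_PiE)
    show "inj_on (\<lambda>s. restrict s (UNIV - {i0})) ?Z"
    proof (rule inj_onI)
      fix r s assume r: "r \<in> ?Z" and s: "s \<in> ?Z" and eq: "restrict r (UNIV - {i0}) = restrict s (UNIV - {i0})"
      have off: "r i = s i" if "i \<noteq> i0" for i using fun_cong[OF eq, of i] that by simp
      have "r i0 + (\<Sum>i\<in>UNIV - {i0}. r i) = s i0 + (\<Sum>i\<in>UNIV - {i0}. s i)"
        using r s by (simp add: sum.remove[symmetric])
      moreover have "(\<Sum>i\<in>UNIV - {i0}. r i) = (\<Sum>i\<in>UNIV - {i0}. s i)" using off by (intro sum.cong) auto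
      ultimately have "r i0 = s i0" by simp
      thus "r = s" using off by (metis ext)
    qed
  qed
  also have "card ?G = (T + 1) ^ (CARD('k) - 1)" by (simp add: card_PiE)
  finally show "card ?Z \<le> (T + 1) ^ (CARD('k) - 1)" .
qed

lemma dyadic_cover:
  fixes d :: "'k::finite \<Rightarrow> real"
  assumes d: "\<And>i. 0 \<le> d i" "\<And>i. d i < 1" and less: "(\<Prod>i\<in>UNIV. d i) < (1/2) ^ M"
  shows "\<exists>s. (\<Sum>i\<in>UNIV. s i) = M - (CARD('k) - 1) \<and> (\<forall>i. d i < (1/2) ^ s i)"
proof -
  let ?k = "CARD('k)"
  (* The exponents are capped at T, which also covers d i = 0, and then lowered until they
     sum to T: lowering an exponent enlarges the box. *)
  let ?T = "M - (?k - 1)"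
  define s' where "s' i = (GREATEST a. a \<le> ?T \<and> d i < (1/2) ^ a)" for i
  have s': "s' i \<le> ?T \<and> d i < (1/2) ^ s' i" for i
    unfolding s'_def by (rule GreatestI_nat[where k = 0 and b = ?T]) (use d in auto)
  have max: "(1/2) ^ Suc (s' i) \<le> d i" if "s' i < ?T" for i
  proof (rule ccontr)
    assume "\<not> (1/2) ^ Suc (s' i) \<le> d i"
    hence "Suc (s' i) \<le> s' i" unfolding s'_def[of i]
      using that by (intro Greatest_le_nat[where b = ?T]) (auto simp: s'_def)
    thus False by simp
  qed
  have "?T \<le> (\<Sum>i\<in>UNIV. s' i)"
  proof (cases "\<exists>i. s' i \<ge> ?T")
    case True
    then obtain i where "s' i \<ge> ?T" by blast
    moreover have "s' i \<le> (\<Sum>i\<in>UNIV. s' i)" by (rule member_le_sum) auto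
    ultimately show ?thesis by linarith
  next
    case False
    \<comment> \<open>With every exponent below the cap, maximality gives d i >= 2^-(s' i + 1), so
      2^-(sum + k) < 2^-M. Strictness yields sum + k >= M + 1, so only k - 1 is lost.\<close>
    have "(1/2) ^ (\<Sum>i\<in>UNIV. Suc (s' i)) = (\<Prod>i\<in>UNIV. (1/2::real) ^ Suc (s' i))" by (rule power_sum)
    also have "\<dots> \<le> (\<Prod>i\<in>UNIV. d i)" using False max by (intro prod_mono) (auto simp: not_le)
    also have "\<dots> < (1/2) ^ M" by fact
    finally have "(1/2::real) ^ (\<Sum>i\<in>UNIV. Suc (s' i)) < (1/2) ^ M" .
    hence "M < (\<Sum>i\<in>UNIV. Suc (s' i))" by (subst (asm) power_strict_decreasing_iff) auto
    thus ?thesis by (simp add: sum_Suc)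
  qed
  from ex_sum_eq_below[OF finite this]
  obtain r where r: "\<forall>i. r i \<le> s' i" "(\<Sum>i\<in>UNIV. r i) = ?T" by blast
  have "d i < (1/2) ^ r i" for i
  proof -
    have "(1/2::real) ^ s' i \<le> (1/2) ^ r i" using r(1) by (intro power_decreasing) auto
    thus ?thesis using s'[of i] by linarith
  qed
  thus ?thesis using r by blast
qed

lemma dist_int_less_1: "dist_int u < 1"
  using dist_int_le_frac[of u] frac_lt_1[of u] by linarith

text \<open>The region is covered by at most (M + 1)^(k-1) boxes, one for each tuple with sum T. A
  box has measure at most 2^k 2^-T, the 2^k coming from the two-sided arcs, and 2^-T <= 2^k 2^-M
  pays for the loss in T = M - (k - 1). Together this gives 4^k.\<close>

lemma measure_mult_near_le:
  fixes y :: "real ^ 'k::finite"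
  assumes n: "n > 0" and \<psi>: "\<psi> \<le> (1/2) ^ M"
  assumes B: "B = {x \<in> unit_cube. (\<Prod>i\<in>UNIV. dist_int (real n * x $ i - y $ i)) < \<psi>}" "B \<in> sets borel"
  shows "measure lborel B \<le> 4 ^ CARD('k) * (real M + 1) ^ (CARD('k) - 1) * (1/2) ^ M"
proof -
  let ?k = "CARD('k)"
  define T where "T = M - (?k - 1)"
  have T_le: "T \<le> M" unfolding T_def by (rule diff_le_self)
  let ?Z = "{s :: 'k \<Rightarrow> nat. (\<Sum>i\<in>UNIV. s i) = T}"
  let ?E = "\<lambda>s. {x::real^'k. \<forall>i. x $ i \<in> near n (y $ i) ((1/2) ^ s i)}"
  have E: "?E s \<in> sets borel" for s by (rule borel_vec_box) simp
  have Esub: "?E s \<subseteq> unit_cube" for s by (auto simp: near_def unit_cube_def)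
  have "B \<subseteq> (\<Union>s\<in>?Z. ?E s)"
  proof
    fix x assume x: "x \<in> B"
    have "(\<Prod>i\<in>UNIV. dist_int (real n * x $ i - y $ i)) < (1/2) ^ M" using x \<psi> B(1) by auto
    from dyadic_cover[of "\<lambda>i. dist_int (real n * x $ i - y $ i)", OF dist_int_nonneg dist_int_less_1 this]
    obtain s where "(\<Sum>i\<in>UNIV. s i) = T" "\<forall>i. dist_int (real n * x $ i - y $ i) < (1/2) ^ s i"
      by (auto simp: T_def)
    moreover have "\<forall>i. x $ i \<in> {0..<1}" using x B(1) by (simp add: unit_cube_def)
    ultimately show "x \<in> (\<Union>s\<in>?Z. ?E s)" by (auto simp: near_def)
  qed
  moreover have "(\<Union>s\<in>?Z. ?E s) \<in> fmeasurable lborel"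
  proof (rule fmeasurableI)
    show "(\<Union>s\<in>?Z. ?E s) \<in> sets lborel" using E card_sum_eq_le(1) by (intro sets.finite_UN) auto
    have "emeasure lborel (\<Union>s\<in>?Z. ?E s) \<noteq> \<infinity>" using Esub by (intro emeasure_cube_subset_finite) blast
    thus "emeasure lborel (\<Union>s\<in>?Z. ?E s) < \<infinity>" by (simp add: less_top)
  qed
  ultimately have "measure lborel B \<le> measure lborel (\<Union>s\<in>?Z. ?E s)"
    using B(2) by (intro measure_mono_fmeasurable) auto
  also have "\<dots> \<le> (\<Sum>s\<in>?Z. measure lborel (?E s))"
    using E card_sum_eq_le(1) by (intro measure_UNION_le) auto
  also have "\<dots> \<le> (\<Sum>s\<in>?Z. 2 ^ ?k * (1/2) ^ T)"
  proof (rule sum_mono)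
    fix s assume s: "s \<in> ?Z"
    have "measure lborel (?E s) = (\<Prod>i\<in>UNIV. measure lborel (near n (y $ i) ((1/2) ^ s i)))"
      by (rule measure_lborel_vec_prod) simp
    also have "\<dots> \<le> (\<Prod>i\<in>UNIV. 2 * (1/2) ^ s i)"
      by (intro prod_mono conjI measure_near_le n measure_nonneg) (auto intro: power_le_one)
    also have "\<dots> = 2 ^ ?k * (1/2) ^ (\<Sum>i\<in>UNIV. s i)" by (simp only: prod.distrib prod_constant power_sum)
    finally show "measure lborel (?E s) \<le> 2 ^ ?k * (1/2) ^ T" using s by simp
  qed
  also have "\<dots> = real (card ?Z) * (2 ^ ?k * (1/2) ^ T)" by simp
  also have "\<dots> \<le> (real M + 1) ^ (?k - 1) * (2 ^ ?k * (2 ^ ?k * (1/2) ^ M))"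
  proof (intro mult_mono mult_left_mono)
    have "real (card ?Z) \<le> real ((T + 1) ^ (?k - 1))" using card_sum_eq_le(2)[of T] by (simp only: of_nat_le_iff)
    also have "\<dots> = (real T + 1) ^ (?k - 1)" by (simp add: add.commute)
    also have "\<dots> \<le> (real M + 1) ^ (?k - 1)" by (intro power_mono) (auto simp: T_le)
    finally show "real (card ?Z) \<le> (real M + 1) ^ (?k - 1)" .
    have "M \<le> T + ?k" by (simp add: T_def)
    hence "(1/2::real) ^ (T + ?k) \<le> (1/2) ^ M" by (intro power_decreasing) auto
    hence "2 ^ ?k * (1/2) ^ (T + ?k) \<le> 2 ^ ?k * (1/2::real) ^ M" by (intro mult_left_mono) auto
    thus "(1/2::real) ^ T \<le> 2 ^ ?k * (1/2) ^ M" by (simp add: power_add power_one_over)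
  qed auto
  also have "\<dots> = 4 ^ ?k * (real M + 1) ^ (?k - 1) * (1/2) ^ M"
  proof -
    have "(4::real) ^ ?k = (2 * 2) ^ ?k" by simp
    also have "\<dots> = 2 ^ ?k * 2 ^ ?k" by (rule power_mult_distrib)
    finally show ?thesis by simp
  qed
  finally show ?thesis .
qed

lemma summable_ln_power_div_square: "summable (\<lambda>n. real n powr - 2 * ln (real n) ^ j)"
proof (rule summable_comparison_test_ev)
  \<comment> \<open>An auxiliary exponent, not the dimension: ln n <= 2 k n^(1/(2k)), and k = j + 1
    is positive even for j = 0 and makes j/(2k) <= 1/2. The logarithms then cost at most n^(1/2),
    leaving n^(-3/2).\<close>
  define k where "k = real j + 1"
  have k: "k > 0" by (simp add: k_def)
  show "summable (\<lambda>n. (2 * k) ^ j * real n powr - (3/2))"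
    by (intro summable_mult) (simp add: summable_real_powr_iff)
  show "eventually (\<lambda>n. norm (real n powr - 2 * ln (real n) ^ j) \<le> (2 * k) ^ j * real n powr - (3/2)) at_top"
    using eventually_ge_at_top[of 1]
  proof eventually_elim
    case (elim n)
    have "ln (real n) = 2 * k * ln (real n powr (1 / (2 * k)))" using elim k by (simp add: ln_powr)
    also have "\<dots> \<le> 2 * k * real n powr (1 / (2 * k))"
      using elim k by (intro mult_left_mono order.trans[OF ln_bound]) auto
    finally have l: "ln (real n) \<le> 2 * k * real n powr (1 / (2 * k))" .
    have l0: "0 \<le> ln (real n)" using elim by simp
    have "ln (real n) ^ j \<le> (2 * k * real n powr (1 / (2 * k))) ^ j" using l l0 by (rule power_mono)
    also have "\<dots> = (2 * k) ^ j * real n powr (real j / (2 * k))"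
      using elim by (simp add: power_mult_distrib powr_powr flip: powr_realpow)
    also have "\<dots> \<le> (2 * k) ^ j * real n powr (1/2)"
      using elim k by (intro mult_left_mono powr_mono) (auto simp: k_def field_simps)
    finally have "real n powr - 2 * ln (real n) ^ j \<le> real n powr - 2 * ((2 * k) ^ j * real n powr (1/2))"
      by (intro mult_left_mono) auto
    also have "\<dots> = (2 * k) ^ j * (real n powr - 2 * real n powr (1/2))" by (simp only: mult.left_commute)
    also have "real n powr - 2 * real n powr (1/2) = real n powr - (3/2)" by (simp flip: powr_add)
    finally show ?case using l0 by simp
  qed
qed

lemma W_mult_null:
  fixes y :: "real ^ 'k::finite" and \<psi> :: "nat \<Rightarrow> real"
  assumes \<psi>: "\<And>n. n \<ge> 1 \<Longrightarrow> 0 \<le> \<psi> n \<and> \<psi> n < 1"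
    and sum: "summable (\<lambda>n. \<psi> (n + 1) * ln (real (n + 1)) ^ (CARD('k) - 1))"
  shows "emeasure lborel (W_mult \<psi> y) = 0"
proof -
  let ?k = "CARD('k)"
  let ?l = "\<lambda>n. ln (real n) ^ (?k - 1)"
  define B where "B n = {x \<in> unit_cube. n \<ge> 1 \<and> (\<Prod>i\<in>UNIV. dist_int (real n * x $ i - y $ i)) < \<psi> n}" for n
  have Bb: "B n \<in> sets borel" for n
  proof (cases "n \<ge> 1")
    case True
    have "unit_cube \<inter> {x::real^'k. (\<Prod>i\<in>UNIV. dist_int (real n * x $ i - y $ i)) < \<psi> n} \<in> sets borel"
      by (rule sets.Int[OF borel_unit_cube borel_prod_dist_int_less])
    thus ?thesis using True by (simp add: B_def Int_def)
  next
    case False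
    hence "B n = {}" unfolding B_def by blast
    thus ?thesis by simp
  qed
  \<comment> \<open>4^k comes from the volume of the cover, 3 / ln 2 from M + 1 <= 3 ln n / ln 2,
    and 2 from 2^-M <= 2 p.\<close>
  define c where "c = 4 ^ ?k * (3 / ln 2) ^ (?k - 1) * (2::real)"
  have ev: "eventually (\<lambda>n. norm (measure lborel (B n)) \<le> c * (\<psi> n * ?l n + real n powr - 2 * ?l n)) at_top"
    \<comment> \<open>From n >= 2 come n^-2 < 1, hence p < 1, and ln n / ln 2 >= 1, which absorbs
      the + 1 in M + 1.\<close>
    using eventually_ge_at_top[of 2]
  proof eventually_elim
    case (elim n)
    \<comment> \<open>Positive even where \<psi> n = 0, so that its logarithm makes sense; bounding
      the maximum by the sum keeps the resulting series summable.\<close>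
    define p where "p = max (\<psi> n) (real n powr - 2)"
    have "real n powr - 2 < 1" using elim powr_less_mono2_neg[of "-2" 1 "real n"] by simp
    moreover have "0 < real n powr - 2" using elim by simp
    ultimately have p: "0 < p" "p < 1" "\<psi> n \<le> p" "real n powr - 2 \<le> p" "p \<le> \<psi> n + real n powr - 2"
      using elim \<psi>[of n] unfolding p_def by linarith+
    define M where "M = nat \<lfloor>log 2 (1 / p)\<rfloor>"
    have lpos: "log 2 (1 / p) > 0" using p by (subst zero_less_log_cancel_iff) auto
    have M: "real M \<le> log 2 (1 / p)" "log 2 (1 / p) < real M + 1" using lpos unfolding M_def by linarith+
    have "2 powr real M \<le> 2 powr log 2 (1 / p)" using M by (intro powr_mono) auto
    hence M1: "p \<le> (1/2) ^ M" using p by (simp add: powr_realpow field_simps power_one_over)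
    have "2 powr log 2 (1 / p) \<le> 2 powr (real M + 1)" using M by (intro powr_mono) auto
    hence M2: "(1/2) ^ M \<le> 2 * p" using p by (simp add: powr_add powr_realpow field_simps power_one_over)
    have "1 / p \<le> real n powr 2" using p elim by (simp add: powr_minus field_simps)
    hence "log 2 (1 / p) \<le> log 2 (real n powr 2)" using p elim by (subst log_le_cancel_iff) auto
    also have "\<dots> = 2 * ln (real n) / ln 2" using elim by (simp add: log_def ln_powr del: powr_numeral)
    finally have "real M \<le> 2 * ln (real n) / ln 2" using M by linarith
    moreover have "1 \<le> ln (real n) / ln 2" using elim by (simp add: field_simps)
    moreover have "3 / ln 2 * ln (real n) = 2 * ln (real n) / ln 2 + ln (real n) / ln 2"
      by (simp flip: add_divide_distrib)
    ultimately have "real M + 1 \<le> 3 / ln 2 * ln (real n)" by linarith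
    hence Mp: "(real M + 1) ^ (?k - 1) \<le> (3 / ln 2 * ln (real n)) ^ (?k - 1)" by (rule power_mono) simp
    have l0: "0 \<le> ?l n" using elim by simp
    have "measure lborel (B n) \<le> 4 ^ ?k * (real M + 1) ^ (?k - 1) * (1/2) ^ M"
    proof (rule measure_mult_near_le)
      show "0 < n" using elim by simp
      show "\<psi> n \<le> (1/2) ^ M" using p(3) M1 by linarith
      show "B n = {x \<in> unit_cube. (\<Prod>i\<in>UNIV. dist_int (real n * x $ i - y $ i)) < \<psi> n}"
        using elim by (simp add: B_def)
      show "B n \<in> sets borel" by (rule Bb)
    qed
    also have "\<dots> \<le> 4 ^ ?k * (3 / ln 2 * ln (real n)) ^ (?k - 1) * (2 * (\<psi> n + real n powr - 2))"
    proof (rule mult_mono)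
      show "4 ^ ?k * (real M + 1) ^ (?k - 1) \<le> 4 ^ ?k * (3 / ln 2 * ln (real n)) ^ (?k - 1)"
        using Mp by (rule mult_left_mono) simp
      show "(1/2) ^ M \<le> 2 * (\<psi> n + real n powr - 2)" by (rule order_trans[OF M2 mult_left_mono[OF p(5)]]) simp
      have "0 \<le> 3 / ln 2 * ln (real n)" using elim by simp
      thus "0 \<le> 4 ^ ?k * (3 / ln 2 * ln (real n)) ^ (?k - 1)" by (intro mult_nonneg_nonneg[OF _ zero_le_power]) auto
    qed simp
    also have "\<dots> = c * (\<psi> n * ?l n + real n powr - 2 * ?l n)"
      unfolding c_def power_mult_distrib by (simp add: algebra_simps)
    finally show ?case by simp
  qed
  have "summable (\<lambda>n. \<psi> n * ?l n)"
    using summable_iff_shift[of "\<lambda>n. \<psi> n * ?l n" 1] sum by simp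
  hence "summable (\<lambda>n. c * (\<psi> n * ?l n + real n powr - 2 * ?l n))"
    by (intro summable_mult summable_add summable_ln_power_div_square)
  hence sm: "summable (\<lambda>n. measure lborel (B n))" by (rule summable_comparison_test_ev[OF ev])
  have fin: "emeasure lborel (B n) < \<infinity>" for n
    using emeasure_cube_subset_finite[of "B n"] by (auto simp: B_def less_top)
  have null: "limsup B \<in> null_sets lborel"
    by (rule borel_cantelli_limsup1[OF _ fin sm]) (simp add: Bb)
  have sub: "W_mult \<psi> y \<subseteq> limsup B"
  proof
    fix x assume "x \<in> W_mult \<psi> y"
    hence "infinite {n. x \<in> B n}" by (simp add: W_mult_def B_def unit_cube_def)
    hence "\<forall>m. \<exists>n\<ge>m. x \<in> B n" by (simp add: infinite_nat_iff_unbounded_le)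
    thus "x \<in> limsup B" by (auto simp: limsup_INF_SUP)
  qed
  have "W_mult \<psi> y \<in> null_sets lborel"
    by (rule null_sets_subset[OF null _ sub]) (simp add: borel_W_mult)
  thus ?thesis by auto
qed

theorem mainTheorem5:
  fixes y :: "real ^ 'k" and \<psi> :: "nat \<Rightarrow> real"
  assumes psi_range: "\<And>n. n \<ge> 1 \<Longrightarrow> 0 \<le> \<psi> n \<and> \<psi> n < 1"
  shows "(summable (\<lambda>n. \<psi> (n + 1) * ln (real (n + 1)) ^ (CARD('k) - 1)) \<longrightarrow>
            W_mult \<psi> y \<in> sets lebesgue \<and> emeasure lebesgue (W_mult \<psi> y) = 0)
       \<and> (CARD('k) \<ge> 3 \<and>
          (\<exists>\<epsilon>::real. 0 < \<epsilon> \<and> \<epsilon> \<le> 1 \<and> \<psi> \<in> O(\<lambda>n. real n powr - \<epsilon>)) \<and>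
          \<not> summable (\<lambda>n. \<psi> (n + 1) * ln (real (n + 1)) ^ (CARD('k) - 1)) \<longrightarrow>
            W_mult \<psi> y \<in> sets lebesgue \<and> emeasure lebesgue (W_mult \<psi> y) = 1)"
proof -
  \<comment> \<open>\<open>W_mult\<close> is Borel, so passing to the completion changes neither its
    measurability nor its measure.\<close>
  have meas: "W_mult \<psi> y \<in> sets lebesgue" using borel_W_mult by (intro sets_completionI_sets) simp
  have "W_mult \<psi> y \<in> sets lborel" using borel_W_mult by simp
  hence em: "emeasure lebesgue (W_mult \<psi> y) = emeasure lborel (W_mult \<psi> y)" by simp
  show ?thesis
  proof (intro conjI impI)
    assume conv: "summable (\<lambda>n. \<psi> (n + 1) * ln (real (n + 1)) ^ (CARD('k) - 1))"
    show "emeasure lebesgue (W_mult \<psi> y) = 0"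
      unfolding em by (rule W_mult_null[OF _ conv]) (rule psi_range)
  next
    assume *: "CARD('k) \<ge> 3 \<and>
      (\<exists>\<epsilon>::real. 0 < \<epsilon> \<and> \<epsilon> \<le> 1 \<and> \<psi> \<in> O(\<lambda>n. real n powr - \<epsilon>)) \<and>
      \<not> summable (\<lambda>n. \<psi> (n + 1) * ln (real (n + 1)) ^ (CARD('k) - 1))"
    then obtain \<epsilon> :: real where \<epsilon>: "0 < \<epsilon>" "\<epsilon> \<le> 1" "\<psi> \<in> O(\<lambda>n. real n powr - \<epsilon>)" by blast
    have k: "CARD('k) \<ge> 3" using * by blast
    have div: "\<not> summable (\<lambda>n. \<psi> (n + 1) * ln (real (n + 1)) ^ (CARD('k) - 1))" using * by blast
    show "emeasure lebesgue (W_mult \<psi> y) = 1"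
      unfolding em by (rule W_mult_full[OF _ k \<epsilon> div]) (rule psi_range)
  qed (rule meas)+
qed

end
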